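(* Let $X$ be a compact Hausdorff space, $\Delta_1\subset X$ clopen, $\alpha:\Delta_1\to X$ continuous with open image $\Delta_{-1}$, $\mathcal{A}=C(X)$, and let $\delta:\mathcal{A}\to\mathcal{A}$ be the endomorphism $\delta(a)=a\circ\alpha$ on $\Delta_1$, $\delta(a)=0$ off $\Delta_1$. If $\delta$ is a monomorphism, then the mapping $\overline\pi\mapsto\overline\pi|_{\mathcal{A}}$ (that is, $(\overline\pi,U,H)\mapsto(\overline\pi|_{\mathcal{A}},U,H)$) establishes a bijection from $\mathrm{CovRep}(\mathcal{B},\widetilde\delta)$ onto $\mathrm{CovRep}(\mathcal{A},\delta)$.
   Context: For $n\ge1$, $\Delta_n$ is the domain of $\alpha^n$; $\Delta_0=X$. For a subset $K$ of a space $Y$, $C_K(Y)$ denotes the continuous functions on $Y$ vanishing outside $K$. Covariant representation of $(\mathcal{A},\delta)$: a triple $(\pi,U,H)$ where $\pi:\mathcal{A}\to L(H)$ is a representation (not necessarily faithful) on a Hilbert space $H$ and $U\in L(H)$ is a partial isometry with initial space $\pi(C_{\Delta_{-1}}(X))H$ and final space $\pi(C_{\Delta_1}(X))H$, such that $U\pi(a)U^*=\pi(\delta(a))$ for $a\in\mathcal{A}$. $\mathrm{CovRep}(\mathcal{A},\delta)$ is the set of these. Reversible extension: adjoin to $X$ an isolated point, denoted $0$. $\widetilde X=\bigcup_{N\ge0}X_N\cup X_\infty\subset\prod_{n=0}^\infty(X\cup\{0\})$ with the topology induced from the product topology, where $X_N=\{(x_0,\dots,x_N,0,0,\dots):x_n\in\Delta_n,\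 x_N\notin\Delta_{-1},\ \alpha(x_n)=x_{n-1}\text{ for }1\le n\le N\}$ and $X_\infty=\{(x_0,x_1,\dots):x_n\in\Delta_n,\ \alpha(x_n)=x_{n-1}\text{ for }n\ge1\}$. Let $\Phi(x_0,x_1,\dots)=x_0$, $\widetilde\Delta_{\pm1}=\Phi^{-1}(\Delta_{\pm1})$ (clopen), and let $\widetilde\alpha:\widetilde\Delta_1\to\widetilde\Delta_{-1}$ be the homeomorphism $\widetilde\alpha(x_0,x_1,\dots)=(\alpha(x_0),x_0,x_1,\dots)$. Coefficient algebra: $\mathcal{B}=C(\widetilde X)$, containing $\mathcal{A}$ via $a\mapsto a\circ\Phi$. $\widetilde\delta:\mathcal{B}\to\mathcal{B}$ is the endomorphism $\widetilde\delta(b)=b\circ\widetilde\alpha$ on $\widetilde\Delta_1$, $0$ off $\widetilde\Delta_1$. $\mathrm{CovRep}(\mathcal{B},\widetilde\delta)$ is the set of triples $(\rho,U,H)$ where $\rho:\mathcal{B}\to L(H)$ is a representation (not necessarily faithful) on a Hilbert space $H$ and $U\in L(H)$ is a partial isometry with initial space $\rho(C_{\widetilde\Delta_{-1}}(\widetilde X))H$ and final space $\rho(C_{\widetilde\Delta_1}(\widetilde X))H$, such that $U\rho(b)U^*=\rho(\widetilde\delta(b))$ for $b\in\mathcal{B}$. *)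

theory Defs
  imports "HOL-Analysis.Analysis"
begin

section \<open>Operators on complex Hilbert spaces\<close>

text \<open>
  The real structure is the underlying real Hilbert space: its inner product is the real part of
  the complex one, so that norm, topology and completeness are the usual ones.
  The complex inner product is linear in the first argument.
\<close>

class complex_hilbert_space = real_inner + complete_space +
  fixes cscale :: "complex \<Rightarrow> 'a \<Rightarrow> 'a"  (infixr "*\<^sub>C" 75)
    and cinner :: "'a \<Rightarrow> 'a \<Rightarrow> complex"
  assumes cscale_add_right: "c *\<^sub>C (x + y) = c *\<^sub>C x + c *\<^sub>C y"
    and cscale_add_left: "(c + d) *\<^sub>C x = c *\<^sub>C x + d *\<^sub>C x"
    and cscale_cscale: "c *\<^sub>C (d *\<^sub>C x) = (c * d) *\<^sub>C x"
    and cscale_of_real: "complex_of_real r *\<^sub>C x = r *\<^sub>R x"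
    and cinner_add_left: "cinner (x + y) z = cinner x z + cinner y z"
    and cinner_cscale_left: "cinner (c *\<^sub>C x) y = c * cinner x y"
    and cinner_commute: "cinner x y = cnj (cinner y x)"
    and inner_eq_Re_cinner: "inner x y = Re (cinner x y)"

instantiation complex :: complex_hilbert_space
begin

definition cscale_complex :: "complex \<Rightarrow> complex \<Rightarrow> complex"
  where "cscale_complex c x = c * x"

definition cinner_complex :: "complex \<Rightarrow> complex \<Rightarrow> complex"
  where "cinner_complex x y = x * cnj y"

instance
  by standard (auto simp: cscale_complex_def cinner_complex_def algebra_simps scaleR_conv_of_real
      inner_complex_def)

end

definition bounded_operators :: "('h::complex_hilbert_space \<Rightarrow> 'h) set"
  where "bounded_operators = {T. bounded_linear T \<and> (\<forall>c x. T (c *\<^sub>C x) = c *\<^sub>C T x)}"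

definition cadjoint :: "('h::complex_hilbert_space \<Rightarrow> 'h) \<Rightarrow> 'h \<Rightarrow> 'h"
  where "cadjoint T = (THE S. \<forall>x y. cinner (T x) y = cinner x (S y))"

definition initial_space :: "('h::complex_hilbert_space \<Rightarrow> 'h) \<Rightarrow> 'h set"
  where "initial_space U = {x. \<forall>y. U y = 0 \<longrightarrow> cinner x y = 0}"

definition final_space :: "('h::complex_hilbert_space \<Rightarrow> 'h) \<Rightarrow> 'h set"
  where "final_space U = range U"

definition partial_isometry :: "('h::complex_hilbert_space \<Rightarrow> 'h) \<Rightarrow> bool"
  where "partial_isometry U \<longleftrightarrow>
    U \<in> bounded_operators \<and> (\<forall>x\<in>initial_space U. norm (U x) = norm x)"


section \<open>The algebra of continuous functions and its representations\<close>

text \<open>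
  A function on the carrier of \<open>Y\<close> is represented by its extension by zero to the whole type, so
  that sums, products and conjugates in the algebra are pointwise and equality is
  equality on \<open>topspace Y\<close>.  The unit is the indicator function of \<open>topspace Y\<close>.
\<close>

definition cfunctions :: "'a topology \<Rightarrow> ('a \<Rightarrow> complex) set"
  where "cfunctions Y = {f. continuous_map Y euclidean f \<and> (\<forall>x. x \<notin> topspace Y \<longrightarrow> f x = 0)}"

definition cfunctions_on :: "'a set \<Rightarrow> 'a topology \<Rightarrow> ('a \<Rightarrow> complex) set"
  where "cfunctions_on K Y = {f \<in> cfunctions Y. \<forall>x. x \<notin> K \<longrightarrow> f x = 0}"

text \<open>
  Representations need be neither faithful nor unital.  They are taken to be extensional, so
  that equality of representations is equality on the algebra.
\<close>

definition representation ::
    "'a topology \<Rightarrow> (('a \<Rightarrow> complex) \<Rightarrow> 'h::complex_hilbert_space \<Rightarrow> 'h) \<Rightarrow> bool"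
  where "representation Y \<pi> \<longleftrightarrow>
    \<pi> \<in> cfunctions Y \<rightarrow>\<^sub>E bounded_operators \<and>
    (\<forall>a\<in>cfunctions Y. \<forall>b\<in>cfunctions Y. \<pi> (\<lambda>x. a x + b x) = (\<lambda>h. \<pi> a h + \<pi> b h)) \<and>
    (\<forall>c. \<forall>a\<in>cfunctions Y. \<pi> (\<lambda>x. c * a x) = (\<lambda>h. c *\<^sub>C \<pi> a h)) \<and>
    (\<forall>a\<in>cfunctions Y. \<forall>b\<in>cfunctions Y. \<pi> (\<lambda>x. a x * b x) = \<pi> a \<circ> \<pi> b) \<and>
    (\<forall>a\<in>cfunctions Y. \<pi> (\<lambda>x. cnj (a x)) = cadjoint (\<pi> a))"

definition endo :: "'a set \<Rightarrow> ('a \<Rightarrow> 'a) \<Rightarrow> ('a \<Rightarrow> complex) \<Rightarrow> 'a \<Rightarrow> complex"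
  where "endo D f a = (\<lambda>x. if x \<in> D then a (f x) else 0)"

lemma endo_in_cfunctions:
  assumes "openin Y D" "closedin Y D" "continuous_map (subtopology Y D) Y f"
    and "a \<in> cfunctions Y"
  shows "endo D f a \<in> cfunctions Y"
proof -
  have a: "continuous_map Y euclidean a"
    using assms(4) by (simp add: cfunctions_def)
  have D: "D \<subseteq> topspace Y" using assms(1) by (rule openin_subset)
  have c: "continuous_map (subtopology Y D) euclidean (\<lambda>x. a (f x))"
    using continuous_map_compose[OF assms(3) a] by (simp add: o_def)
  have "openin Y {x \<in> topspace Y. endo D f a x \<in> V}" if V: "open V" for V
  proof -
    have "openin (subtopology Y D) {x \<in> topspace (subtopology Y D). a (f x) \<in> V}"
      using c V by (intro openin_continuous_map_preimage) auto
    then have 1: "openin Y {x \<in> D. a (f x) \<in> V}"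
      using D assms(1) by (simp add: openin_open_subtopology inf_absorb2)
    have 2: "openin Y (topspace Y - D)" using assms(2) by blast
    have "{x \<in> topspace Y. endo D f a x \<in> V} =
        {x \<in> D. a (f x) \<in> V} \<union> (if 0 \<in> V then topspace Y - D else {})"
      using D by (auto simp: endo_def)
    then show ?thesis using 1 2 by auto
  qed
  then show ?thesis
    using D by (auto simp: cfunctions_def continuous_map_def endo_def)
qed

text \<open>
  The Hilbert space of a triple \<open>(\<pi>, U, H)\<close> is the type \<open>'h\<close>, so only \<open>(\<pi>, U)\<close> is recorded.
  The sets \<open>D1\<close> and \<open>Dm1\<close> are the domain and the image of the partial map inducing \<open>\<delta>\<close>.
\<close>

definition CovRep ::
    "'a topology \<Rightarrow> 'a set \<Rightarrow> 'a set \<Rightarrow> (('a \<Rightarrow> complex) \<Rightarrow> 'a \<Rightarrow> complex) \<Rightarrow>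
      ((('a \<Rightarrow> complex) \<Rightarrow> 'h \<Rightarrow> 'h) \<times> ('h::complex_hilbert_space \<Rightarrow> 'h)) set"
  where "CovRep Y D1 Dm1 \<delta> = {(\<pi>, U).
    representation Y \<pi> \<and>
    partial_isometry U \<and>
    initial_space U = {\<pi> a h | a h. a \<in> cfunctions_on Dm1 Y} \<and>
    final_space U = {\<pi> a h | a h. a \<in> cfunctions_on D1 Y} \<and>
    (\<forall>a\<in>cfunctions Y. U \<circ> \<pi> a \<circ> cadjoint U = \<pi> (\<delta> a))}"


section \<open>The reversible extension\<close>

text \<open>The space \<open>X \<union> {0}\<close>, with \<open>None\<close> as the adjoined isolated point \<open>0\<close>.\<close>

definition adjoin_point :: "'a topology \<Rightarrow> 'a option topology"
  where "adjoin_point X =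
    topology (\<lambda>U. U \<subseteq> insert None (Some ` topspace X) \<and> openin X {x. Some x \<in> U})"

lemma openin_adjoin_point:
  "openin (adjoin_point X) U \<longleftrightarrow>
    U \<subseteq> insert None (Some ` topspace X) \<and> openin X {x. Some x \<in> U}"
proof -
  have "istopology (\<lambda>U. U \<subseteq> insert None (Some ` topspace X) \<and> openin X {x. Some x \<in> U})"
    unfolding istopology_def
  proof (intro conjI allI impI)
    fix S T :: "'a option set"
    assume "S \<subseteq> insert None (Some ` topspace X) \<and> openin X {x. Some x \<in> S}"
      and "T \<subseteq> insert None (Some ` topspace X) \<and> openin X {x. Some x \<in> T}"
    moreover have "{x. Some x \<in> S \<inter> T} = {x. Some x \<in> S} \<inter> {x. Some x \<in> T}" by auto
    ultimately show "S \<inter> T \<subseteq> insert None (Some ` topspace X)" "openin X {x. Some x \<in> S \<inter> T}"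
      by auto
  next
    fix K :: "'a option set set"
    assume K: "\<forall>S\<in>K. S \<subseteq> insert None (Some ` topspace X) \<and> openin X {x. Some x \<in> S}"
    then show "\<Union>K \<subseteq> insert None (Some ` topspace X)" by blast
    have "{x. Some x \<in> \<Union>K} = (\<Union>S\<in>K. {x. Some x \<in> S})" by auto
    with K show "openin X {x. Some x \<in> \<Union>K}" by auto
  qed
  then show ?thesis by (simp add: adjoin_point_def topology_inverse')
qed

context
  fixes X :: "'a topology" and D1 :: "'a set" and \<alpha> :: "'a \<Rightarrow> 'a"
begin

text \<open>The domain of the \<open>n\<close>-th iterate of the partial map \<open>\<alpha>\<close> with domain \<open>D1\<close>.\<close>

primrec iter_dom :: "nat \<Rightarrow> 'a set"
  where
    "iter_dom 0 = topspace X"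
  | "iter_dom (Suc n) = {x \<in> D1. \<alpha> x \<in> iter_dom n}"

definition ext_fin :: "nat \<Rightarrow> (nat \<Rightarrow> 'a option) set"
  where "ext_fin N = {(\<lambda>n. if n \<le> N then Some (x n) else None) | x.
    (\<forall>n\<le>N. x n \<in> iter_dom n) \<and> x N \<notin> \<alpha> ` D1 \<and> (\<forall>n\<in>{1..N}. \<alpha> (x n) = x (n - 1))}"

definition ext_inf :: "(nat \<Rightarrow> 'a option) set"
  where "ext_inf = {(\<lambda>n. Some (x n)) | x.
    (\<forall>n. x n \<in> iter_dom n) \<and> (\<forall>n\<ge>1. \<alpha> (x n) = x (n - 1))}"

definition ext_space :: "(nat \<Rightarrow> 'a option) topology"
  where "ext_space =
    subtopology (product_topology (\<lambda>_. adjoin_point X) UNIV) ((\<Union>N. ext_fin N) \<union> ext_inf)"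

definition ext_proj :: "(nat \<Rightarrow> 'a option) \<Rightarrow> 'a"
  where "ext_proj s = the (s 0)"

definition ext_preimage :: "'a set \<Rightarrow> (nat \<Rightarrow> 'a option) set"
  where "ext_preimage D = {s \<in> topspace ext_space. ext_proj s \<in> D}"

definition ext_map :: "(nat \<Rightarrow> 'a option) \<Rightarrow> nat \<Rightarrow> 'a option"
  where "ext_map s = (\<lambda>n. case n of 0 \<Rightarrow> Some (\<alpha> (ext_proj s)) | Suc m \<Rightarrow> s m)"

text \<open>The embedding \<open>a \<mapsto> a \<circ> \<Phi>\<close> of \<open>C(X)\<close> into the coefficient algebra, where \<open>\<Phi>\<close> is
  \<^const>\<open>ext_proj\<close>, and the restriction of representations along it.\<close>

definition ext_embed :: "('a \<Rightarrow> complex) \<Rightarrow> (nat \<Rightarrow> 'a option) \<Rightarrow> complex"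
  where "ext_embed a = (\<lambda>s. if s \<in> topspace ext_space then a (ext_proj s) else 0)"

definition restrict_rep ::
    "(((nat \<Rightarrow> 'a option) \<Rightarrow> complex) \<Rightarrow> 'h \<Rightarrow> 'h) \<Rightarrow> ('a \<Rightarrow> complex) \<Rightarrow> 'h \<Rightarrow> 'h"
  where "restrict_rep \<rho> = (\<lambda>a\<in>cfunctions X. \<rho> (ext_embed a))"

end

end

theory Submission
  imports Defs
begin

text \<open>
  Injectivity of \<open>\<delta>\<close> means that the clopen set \<open>\<Delta>\<^sub>-\<^sub>1\<close> is all of \<open>X\<close>, so the extended space is the
  inverse limit \<open>X\<^sub>\<infinity>\<close> and the functions \<open>s \<mapsto> a (s n)\<close> of a single coordinate form an increasing
  union of \<open>*\<close>-algebras, dense by Stone--Weierstrass.  Covariance forces an extension of \<open>(\<pi>, U)\<close>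
  to take the value \<open>U\<^sup>*\<^sup>n \<pi>(a) U\<^sup>n\<close> on such a function, which gives uniqueness.  Conversely these
  operators are multiplicative in \<open>a\<close> because \<open>U U\<^sup>* = \<pi>(1\<^bsub>D1\<^esub>)\<close>, independent of the choice of \<open>n\<close>
  because \<open>U\<^sup>* U = \<pi>(1)\<close>, and bounded by the supremum of \<open>\<bar>a\<bar>\<close> over \<open>\<Delta>\<^sub>n\<close>, so they extend by
  continuity to the whole algebra.
\<close>

section \<open>Adjoints\<close>

text \<open>Representations need not be unital, so \<pi>(1) is only a projection, and in general
  \<open>U\<close> is neither an isometry nor a coisometry. Its initial and final spaces are the
  ranges of \<pi>(1) and \<pi>(1_D1). Both projections are images of functions on \<open>X\<close>,
  so these two conditions are the same for a representation of the large algebra and for its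
  restriction; only the covariance relation has to be transported. The obstacle is the norm. A
  function of coordinate n sees \<open>a\<close> only on \<Delta>_n, so the operator at level n has
  to ignore the other values of \<open>a\<close>, although \<pi>(a) does not. The cut-off comes from
  the adjoint of \<open>U\<close>, which absorbs \<pi>(1_D1): at level n this projection is the
  value at the indicator of \<Delta>_(n+1), so that each further conjugation by \<open>U\<close>
  shrinks the relevant set by one step. Since \<alpha> is onto, every point of \<Delta>_n is the
  n-th entry of some thread, and the supremum over \<Delta>_n is therefore the norm in the large
  algebra. The case of supremum 0 shows that equal functions receive equal operators.\<close>

lemma Riesz_representation:
  fixes f :: "'a::{real_inner, complete_space} \<Rightarrow> real"
  assumes "bounded_linear f"
  obtains v where "\<And>x. f x = inner v x"
proof -
  interpret f: bounded_linear f by fact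
  \<comment> \<open>If \<open>f\<close> is the inner product with v, this is |x - v|^2 - |v|^2, so
    the vector sought is the minimiser of \<open>g\<close>.\<close>
  define g where "g x = (norm x)\<^sup>2 - 2 * f x" for x
  obtain K where K: "\<And>x. norm (f x) \<le> norm x * K"
    using f.bounded by blast
  have g_ge: "- K\<^sup>2 \<le> g x" for x
  proof -
    have "0 \<le> (norm x - K)\<^sup>2" by simp
    then show ?thesis using K[of x] by (simp add: g_def power2_diff)
  qed
  define m where "m = Inf (range g)"
  have bdd: "bdd_below (range g)" using g_ge by (auto simp: bdd_below_def)
  have m_le: "m \<le> g x" for x unfolding m_def by (rule cInf_lower) (use bdd in auto)
  have "\<exists>x. g x < m + 1 / Suc k" for k
    using cInf_lessD[of "range g" "m + 1 / Suc k"] unfolding m_def by auto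
  then obtain X where X: "\<And>k. g (X k) < m + 1 / Suc k" by metis
  \<comment> \<open>The parallelogram law, in which the linear terms cancel: near-minimisers are
    close to each other, so a minimising sequence is Cauchy.\<close>
  have par: "(norm (x - y))\<^sup>2 \<le> 2 * (g x - m) + 2 * (g y - m)" for x y
  proof -
    have "(norm (x - y))\<^sup>2 = 2 * g x + 2 * g y - 4 * g ((1/2) *\<^sub>R (x + y))"
      by (simp add: g_def f.scaleR f.add power2_norm_eq_inner inner_diff inner_add
          inner_commute algebra_simps)
    then show ?thesis using m_le[of "(1/2) *\<^sub>R (x + y)"] by simp
  qed
  have "Cauchy X"
  proof (rule metric_CauchyI)
    fix e :: real assume "e > 0"
    then obtain N where N: "inverse (Suc N) < e\<^sup>2 / 4"
      using reals_Archimedean[of "e\<^sup>2/4"] by auto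
    have "dist (X j) (X k) < e" if "j \<ge> N" "k \<ge> N" for j k
    proof -
      have "1 / Suc j \<le> 1 / Suc N" "1 / Suc k \<le> 1 / Suc N"
        using that by (auto simp: field_simps)
      then have "(norm (X j - X k))\<^sup>2 < e\<^sup>2"
        using par[of "X j" "X k"] X[of j] X[of k] N by (simp add: inverse_eq_divide)
      then show ?thesis using \<open>e > 0\<close> by (simp add: dist_norm power_less_imp_less_base)
    qed
    then show "\<exists>M. \<forall>j\<ge>M. \<forall>k\<ge>M. dist (X j) (X k) < e" by blast
  qed
  then obtain v where v: "X \<longlonglongrightarrow> v"
    using Cauchy_convergent convergent_def by blast
  have "(\<lambda>k. g (X k)) \<longlonglongrightarrow> g v"
    unfolding g_def by (intro tendsto_intros f.tendsto v)
  moreover have "(\<lambda>k. m + 1 / Suc k) \<longlonglongrightarrow> m + 0"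
    by (intro tendsto_add tendsto_const LIMSEQ_inverse_real_of_nat[unfolded inverse_eq_divide])
  ultimately have "g v \<le> m"
    using X by (metis (no_types, lifting) LIMSEQ_le add.right_neutral less_imp_le)
  then have g_min: "g v \<le> g y" for y using m_le[of y] by simp
  have "f x = inner v x" for x
  proof -
    define d where "d = inner v x - f x"
    have quad: "0 \<le> t\<^sup>2 * (norm x)\<^sup>2 + 2 * t * d" for t
    proof -
      have "(norm (v + t *\<^sub>R x))\<^sup>2 = (norm v)\<^sup>2 + 2 * t * inner v x + t\<^sup>2 * (norm x)\<^sup>2"
        unfolding power2_norm_eq_inner inner_add_left inner_add_right
        by (simp add: inner_commute algebra_simps power2_eq_square)
      then show ?thesis
        using g_min[of "v + t *\<^sub>R x"] by (simp add: g_def d_def f.add f.scaleR algebra_simps)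
    qed
    show ?thesis
    proof (cases "x = 0")
      case False
      then have "norm x > 0" by simp
      \<comment> \<open>The vertex of the parabola \<open>quad\<close>; a nonzero slope
        \<open>d\<close> at t = 0 would make its value there negative.\<close>
      have "0 \<le> - d\<^sup>2 / (norm x)\<^sup>2"
        using quad[of "- d / (norm x)\<^sup>2"] \<open>norm x > 0\<close>
        by (simp add: field_simps power2_eq_square)
      then have "d = 0" using \<open>norm x > 0\<close> by (simp add: divide_le_0_iff zero_le_divide_iff)
      then show ?thesis by (simp add: d_def)
    qed (simp add: f.zero)
  qed
  then show thesis by (rule that)
qed

text \<open>Antilinearity in the second argument: multiplying it by i turns the imaginary part into
  a real part. Limits, nondegeneracy and polarisation thus carry over from the real inner
  product.\<close>

lemma cinner_eq_Complex: "cinner x y = Complex (inner x y) (inner x (\<i> *\<^sub>C y))"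
proof -
  have "cinner x (\<i> *\<^sub>C y) = - \<i> * cinner x y"
    by (metis cinner_commute cinner_cscale_left complex_cnj_i complex_cnj_mult)
  then show ?thesis by (simp add: inner_eq_Re_cinner complex_eq_iff)
qed

lemma cinner_self: "cinner x x = complex_of_real ((norm x)\<^sup>2)"
proof -
  have "Im (cinner x x) = 0" using cinner_commute[of x x] by (simp add: complex_eq_iff)
  then show ?thesis by (simp add: complex_eq_iff power2_norm_eq_inner inner_eq_Re_cinner)
qed

lemma cinner_cscale_right: "cinner x (c *\<^sub>C y) = cnj c * cinner x y"
  by (metis cinner_commute cinner_cscale_left complex_cnj_mult)

lemma cinner_add_right: "cinner x (y + z) = cinner x y + cinner x z"
  by (metis cinner_commute cinner_add_left complex_cnj_add)

lemma cinner_diff_left: "cinner (x - y) z = cinner x z - cinner y z"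
  using cinner_add_left[of "x - y" y z] by simp

lemma cinner_eq_rightI: "(\<And>x. cinner x y = cinner x z) \<Longrightarrow> y = z"
  by (metis cinner_eq_Complex complex.inject vector_eq_rdot inner_commute)

lemma cinner_eq_leftI: "(\<And>y. cinner x y = cinner z y) \<Longrightarrow> x = z"
  by (metis cinner_commute cinner_eq_rightI)

lemma cinner_zero_right: "cinner x 0 = 0"
  using cinner_add_right[of x 0 0] by simp

lemma tendsto_cinner:
  assumes "(f \<longlongrightarrow> x) F" shows "((\<lambda>k. cinner (f k) y) \<longlongrightarrow> cinner x y) F"
  unfolding cinner_eq_Complex by (intro tendsto_intros assms)

lemma tendsto_cinner_right:
  assumes "(f \<longlongrightarrow> y) F" shows "((\<lambda>k. cinner x (f k)) \<longlongrightarrow> cinner x y) F"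
  by (subst (1 2) cinner_commute) (intro tendsto_cnj tendsto_cinner assms)

lemma norm_cscale: "norm (c *\<^sub>C x) = cmod c * norm x"
proof -
  have "complex_of_real ((norm (c *\<^sub>C x))\<^sup>2) = complex_of_real ((cmod c * norm x)\<^sup>2)"
    by (simp only: cinner_self[symmetric] cinner_cscale_left cinner_cscale_right)
      (simp add: cinner_self power_mult_distrib mult_ac
        complex_norm_square[of c, unfolded of_real_power, symmetric])
  then show ?thesis by (simp only: of_real_eq_iff) (simp add: power2_eq_iff_nonneg)
qed

lemma bounded_linear_cscale: "bounded_linear (\<lambda>x. c *\<^sub>C x)"
proof (rule bounded_linear_intro)
  show "c *\<^sub>C (r *\<^sub>R x) = r *\<^sub>R (c *\<^sub>C x)" for r and x :: 'a
    by (simp add: cscale_of_real[symmetric] cscale_cscale mult.commute)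
  show "norm (c *\<^sub>C x) \<le> norm x * cmod c" for x :: 'a by (simp add: norm_cscale)
qed (rule cscale_add_right)

section \<open>Bounded operators and existence of adjoints\<close>

lemma bounded_operatorsD:
  assumes "T \<in> bounded_operators"
  shows "bounded_linear T" "T (c *\<^sub>C x) = c *\<^sub>C T x" "T (x + y) = T x + T y"
    "T (x - y) = T x - T y" "T 0 = 0"
  using assms
  by (auto simp: bounded_operators_def linear_simps bounded_linear.linear linear_0 linear_diff)

lemma bounded_operatorsI:
  assumes "\<And>x y. T (x + y) = T x + T y" "\<And>c x. T (c *\<^sub>C x) = c *\<^sub>C T x"
    and "\<And>x. norm (T x) \<le> norm x * K"
  shows "T \<in> bounded_operators"
  using assms bounded_linear_intro[of T K]
  by (auto simp: bounded_operators_def simp flip: cscale_of_real)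

lemma bounded_operators_comp:
  "S \<in> bounded_operators \<Longrightarrow> T \<in> bounded_operators \<Longrightarrow> S \<circ> T \<in> bounded_operators"
  by (auto simp: bounded_operators_def o_def intro: bounded_linear_compose)

lemma cadjoint_eqI:
  assumes "\<And>x y. cinner (T x) y = cinner x (S y)"
  shows "cadjoint T = S"
  unfolding cadjoint_def
proof (rule the_equality)
  fix S' assume "\<forall>x y. cinner (T x) y = cinner x (S' y)"
  with assms show "S' = S" by (metis ext cinner_eq_rightI)
qed (use assms in blast)

text \<open>\<open>cadjoint\<close> is a definite description, so existence must be supplied. Riesz
  represents the real part of the inner product; replacing x by -i x, which commutes with
  \<open>T\<close>, recovers the imaginary part.\<close>

lemma cinner_cadjoint_right:
  assumes "T \<in> bounded_operators"
  shows "cinner (T x) y = cinner x (cadjoint T y)"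
proof -
  have "\<exists>v. \<forall>x. inner (T x) y = inner v x" for y
  proof -
    have "bounded_linear (\<lambda>x. inner (T x) y)"
      using bounded_linear_compose[OF bounded_linear_inner_left bounded_operatorsD(1)[OF assms]] .
    then show ?thesis by (metis Riesz_representation)
  qed
  then obtain S where S: "\<And>x y. inner (T x) y = inner (S y) x" by metis
  have "cinner (T x) y = cinner x (S y)" for x y
  proof -
    have "Im (cinner (T x) y) = inner (T (- \<i> *\<^sub>C x)) y"
      by (simp add: bounded_operatorsD[OF assms] inner_eq_Re_cinner cinner_cscale_left)
    also have "\<dots> = inner (- \<i> *\<^sub>C x) (S y)" by (metis S inner_commute)
    also have "\<dots> = Im (cinner x (S y))" by (simp add: inner_eq_Re_cinner cinner_cscale_left)
    finally have "Im (cinner (T x) y) = Im (cinner x (S y))" .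
    moreover have "Re (cinner (T x) y) = Re (cinner x (S y))"
      using S[of x y] by (simp add: inner_eq_Re_cinner[symmetric] inner_commute)
    ultimately show ?thesis by (simp add: complex_eq_iff)
  qed
  then show ?thesis by (subst cadjoint_eqI) auto
qed

lemma cinner_cadjoint_left:
  assumes "T \<in> bounded_operators"
  shows "cinner (cadjoint T x) y = cinner x (T y)"
  by (metis assms cinner_cadjoint_right cinner_commute)

lemma cadjoint_cadjoint: "T \<in> bounded_operators \<Longrightarrow> cadjoint (cadjoint T) = T"
  by (rule cadjoint_eqI) (rule cinner_cadjoint_left)

lemma cadjoint_comp:
  assumes "S \<in> bounded_operators" "T \<in> bounded_operators"
  shows "cadjoint (S \<circ> T) = cadjoint T \<circ> cadjoint S"
  by (rule cadjoint_eqI) (simp add: assms cinner_cadjoint_right)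

lemma cadjoint_bounded_operators:
  assumes T: "T \<in> bounded_operators"
  shows "cadjoint T \<in> bounded_operators"
proof -
  obtain K where K: "\<And>x. norm (T x) \<le> norm x * K" "K \<ge> 0"
    using bounded_linear.nonneg_bounded[OF bounded_operatorsD(1)[OF T]] by blast
  show ?thesis
  proof (rule bounded_operatorsI)
    show "cadjoint T (x + y) = cadjoint T x + cadjoint T y" for x y
      by (rule cinner_eq_leftI) (simp add: cinner_cadjoint_left[OF T] cinner_add_left)
    show "cadjoint T (c *\<^sub>C x) = c *\<^sub>C cadjoint T x" for c x
      by (rule cinner_eq_leftI) (simp add: cinner_cadjoint_left[OF T] cinner_cscale_left)
    fix x
    let ?S = "cadjoint T"
    have "(norm (?S x))\<^sup>2 = inner x (T (?S x))"
      using cinner_cadjoint_left[OF T, of x "?S x"] cinner_self[of "?S x"]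
      by (metis Re_complex_of_real inner_eq_Re_cinner)
    also have "\<dots> \<le> norm x * (norm (?S x) * K)"
      using K(1)[of "?S x"]
      by (meson Cauchy_Schwarz_ineq2 abs_le_D1 mult_left_mono norm_ge_zero order_trans)
    finally show "norm (?S x) \<le> norm x * K"
      using K by (cases "norm (?S x) = 0") (auto simp: power2_eq_square)
  qed
qed

section \<open>Representations of algebras of continuous functions\<close>

lemma cfunctions_add:
  "a \<in> cfunctions Y \<Longrightarrow> b \<in> cfunctions Y \<Longrightarrow> (\<lambda>x. a x + b x) \<in> cfunctions Y"
  by (simp add: cfunctions_def continuous_map_add)

lemma cfunctions_mult:
  "a \<in> cfunctions Y \<Longrightarrow> b \<in> cfunctions Y \<Longrightarrow> (\<lambda>x. a x * b x) \<in> cfunctions Y"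
  by (simp add: cfunctions_def continuous_map_atin tendsto_mult)

lemma cfunctions_cmult: "a \<in> cfunctions Y \<Longrightarrow> (\<lambda>x. c * a x) \<in> cfunctions Y"
  by (simp add: cfunctions_def continuous_map_atin tendsto_mult)

lemma cfunctions_cnj: "a \<in> cfunctions Y \<Longrightarrow> (\<lambda>x. cnj (a x)) \<in> cfunctions Y"
  by (simp add: cfunctions_def continuous_map_atin tendsto_cnj)

lemma cfunctions_diff:
  "a \<in> cfunctions Y \<Longrightarrow> b \<in> cfunctions Y \<Longrightarrow> (\<lambda>x. a x - b x) \<in> cfunctions Y"
  by (simp add: cfunctions_def continuous_map_diff)

lemma cfunctions_restrict_topspace:
  assumes "continuous_map Y euclidean f"
  shows "(\<lambda>x. if x \<in> topspace Y then f x else 0) \<in> cfunctions Y"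
  using continuous_map_eq[OF assms] by (auto simp: cfunctions_def)

lemma cfunctions_indicator:
  assumes "openin Y D" "closedin Y D"
  shows "indicator D \<in> cfunctions Y"
proof -
  have "openin Y {x \<in> topspace Y. (indicator D x :: complex) \<in> V}" for V
  proof -
    have "{x \<in> topspace Y. (indicator D x :: complex) \<in> V} =
        (if 1 \<in> V then D else {}) \<union> (if 0 \<in> V then topspace Y - D else {})"
      using openin_subset[OF assms(1)] by (auto simp: indicator_def)
    moreover have "openin Y (topspace Y - D)" using assms(2) by blast
    ultimately show ?thesis using assms(1) by auto
  qed
  then show ?thesis
    using openin_subset[OF assms(1)]
    by (auto simp: cfunctions_def continuous_map_def indicator_def)
qed

lemma cfunctions_bounded:
  assumes "compact_space Y" "f \<in> cfunctions Y"
  obtains B where "\<And>x. cmod (f x) \<le> B"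
proof -
  have "compactin euclidean (f ` topspace Y)"
    using assms by (intro image_compactin) (auto simp: cfunctions_def compact_space_def)
  then have "bounded (f ` topspace Y)" by (simp add: compact_imp_bounded)
  then obtain B where B: "\<And>x. x \<in> topspace Y \<Longrightarrow> cmod (f x) \<le> B"
    by (auto simp: bounded_iff)
  have "cmod (f x) \<le> max B 0" for x
    using B[of x] assms(2) by (cases "x \<in> topspace Y") (auto simp: cfunctions_def)
  then show thesis by (rule that)
qed

lemma representationD:
  assumes "representation Y \<pi>" "a \<in> cfunctions Y"
  shows representation_bounded: "\<pi> a \<in> bounded_operators"
    and representation_add:
      "b \<in> cfunctions Y \<Longrightarrow> \<pi> (\<lambda>x. a x + b x) = (\<lambda>h. \<pi> a h + \<pi> b h)"
    and representation_cmult: "\<pi> (\<lambda>x. c * a x) = (\<lambda>h. c *\<^sub>C \<pi> a h)"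
    and representation_mult: "b \<in> cfunctions Y \<Longrightarrow> \<pi> (\<lambda>x. a x * b x) = \<pi> a \<circ> \<pi> b"
    and representation_cnj: "\<pi> (\<lambda>x. cnj (a x)) = cadjoint (\<pi> a)"
proof -
  note \<pi> = assms(1)[unfolded representation_def]
  show "\<pi> a \<in> bounded_operators" using PiE_mem[OF conjunct1[OF \<pi>] assms(2)] .
  show "b \<in> cfunctions Y \<Longrightarrow> \<pi> (\<lambda>x. a x + b x) = (\<lambda>h. \<pi> a h + \<pi> b h)"
    "\<pi> (\<lambda>x. c * a x) = (\<lambda>h. c *\<^sub>C \<pi> a h)"
    "b \<in> cfunctions Y \<Longrightarrow> \<pi> (\<lambda>x. a x * b x) = \<pi> a \<circ> \<pi> b"
    "\<pi> (\<lambda>x. cnj (a x)) = cadjoint (\<pi> a)"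
    using \<pi> assms(2) by blast+
qed

lemma cscale_minus_one: "(-1) *\<^sub>C x = - x"
  using cscale_of_real[of "-1" x] by simp

lemma representation_diff:
  assumes "representation Y \<pi>" "a \<in> cfunctions Y" "b \<in> cfunctions Y"
  shows "\<pi> (\<lambda>x. a x - b x) h = \<pi> a h - \<pi> b h"
  using representation_add[OF assms(1,2) cfunctions_cmult[OF assms(3), of "-1"]]
    representation_cmult[OF assms(1,3), of "-1"]
  by (simp add: cscale_minus_one)

lemma representation_cinner:
  assumes "representation Y \<pi>" "a \<in> cfunctions Y"
  shows "cinner (\<pi> (\<lambda>x. cnj (a x) * a x) h) h = complex_of_real ((norm (\<pi> a h))\<^sup>2)"
  using representation_mult[OF assms(1) cfunctions_cnj assms(2), OF assms(2)]
  by (simp add: representation_cnj[OF assms] cinner_cadjoint_left representation_bounded[OF assms]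
      cinner_self)

text \<open>The function \<open>C\<^sup>2 - \<bar>f\<bar>\<^sup>2\<close> is of the form \<open>cnj g * g\<close>, so its image is a positive operator.\<close>

lemma representation_contractive:
  assumes \<pi>: "representation Y \<pi>" and f: "f \<in> cfunctions Y" and C: "\<And>x. cmod (f x) \<le> C"
  shows "norm (\<pi> f h) \<le> C * norm h"
proof -
  define u :: "'a \<Rightarrow> complex" where "u = indicator (topspace Y)"
  have u: "u \<in> cfunctions Y" unfolding u_def by (simp add: cfunctions_indicator)
  have "C \<ge> 0" by (rule order_trans[OF norm_ge_zero C])
  define g where
    "g x = (if x \<in> topspace Y then complex_of_real (sqrt (C\<^sup>2 - (cmod (f x))\<^sup>2)) else 0)" for x
  have g: "g \<in> cfunctions Y"
    unfolding g_def
  proof (rule cfunctions_restrict_topspace)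
    have "continuous_map Y euclidean f" using f by (simp add: cfunctions_def)
    then show "continuous_map Y euclidean (\<lambda>x. complex_of_real (sqrt (C\<^sup>2 - (cmod (f x))\<^sup>2)))"
      unfolding continuous_map_atin limitin_canonical_iff
      by (intro ballI tendsto_of_real tendsto_real_sqrt tendsto_diff tendsto_const tendsto_power
          tendsto_norm) simp
  qed
  have "complex_of_real (C\<^sup>2) * u x = cnj (f x) * f x + cnj (g x) * g x" for x
  proof (cases "x \<in> topspace Y")
    case True
    have "(cmod (f x))\<^sup>2 \<le> C\<^sup>2" using C[of x] by (simp add: power_mono)
    then have "cnj (g x) * g x = complex_of_real (C\<^sup>2 - (cmod (f x))\<^sup>2)"
      using True by (simp only: g_def if_True complex_cnj_complex_of_real of_real_mult[symmetric]) simp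
    moreover have "cnj (f x) * f x = complex_of_real ((cmod (f x))\<^sup>2)"
      by (simp only: complex_norm_square mult.commute)
    ultimately show ?thesis using True by (simp only: of_real_diff u_def indicator_simps) simp
  qed (use f in \<open>auto simp: u_def g_def cfunctions_def\<close>)
  then have dec: "(\<lambda>x. complex_of_real (C\<^sup>2) * u x) = (\<lambda>x. cnj (f x) * f x + cnj (g x) * g x)"
    by (rule ext)
  have uu: "(\<lambda>x. cnj (u x) * u x) = u" by (auto simp: u_def indicator_def)
  have P: "cinner (\<pi> u h) h = complex_of_real ((norm (\<pi> u h))\<^sup>2)"
    using representation_cinner[OF \<pi> u, of h] uu by simp
  have "complex_of_real (C\<^sup>2) * cinner (\<pi> u h) h =
      complex_of_real ((norm (\<pi> f h))\<^sup>2) + complex_of_real ((norm (\<pi> g h))\<^sup>2)"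
  proof -
    have "complex_of_real (C\<^sup>2) * cinner (\<pi> u h) h =
        cinner (\<pi> (\<lambda>x. complex_of_real (C\<^sup>2) * u x) h) h"
      by (simp only: representation_cmult[OF \<pi> u] cinner_cscale_left)
    also have "\<dots> = cinner (\<pi> (\<lambda>x. cnj (f x) * f x) h + \<pi> (\<lambda>x. cnj (g x) * g x) h) h"
      unfolding dec
      by (simp only: representation_add[OF \<pi> cfunctions_mult[OF cfunctions_cnj[OF f] f]
          cfunctions_mult[OF cfunctions_cnj[OF g] g]])
    finally show ?thesis
      by (simp only: cinner_add_left representation_cinner[OF \<pi> f] representation_cinner[OF \<pi> g])
  qed
  then have "C\<^sup>2 * (norm (\<pi> u h))\<^sup>2 = (norm (\<pi> f h))\<^sup>2 + (norm (\<pi> g h))\<^sup>2"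
    unfolding P by (simp only: of_real_mult[symmetric] of_real_add[symmetric] of_real_eq_iff)
  then have "(norm (\<pi> f h))\<^sup>2 \<le> (C * norm (\<pi> u h))\<^sup>2"
    by (simp add: power_mult_distrib)
  then have 1: "norm (\<pi> f h) \<le> C * norm (\<pi> u h)"
    using \<open>C \<ge> 0\<close> by (auto intro: power2_le_imp_le)
  have "(norm (\<pi> u h))\<^sup>2 = inner (\<pi> u h) h" using P by (simp add: inner_eq_Re_cinner)
  also have "\<dots> \<le> norm (\<pi> u h) * norm h" by (rule norm_cauchy_schwarz)
  finally have "norm (\<pi> u h) \<le> norm h"
    by (cases "norm (\<pi> u h) = 0") (auto simp: power2_eq_square)
  then show ?thesis using 1 \<open>C \<ge> 0\<close> by (meson mult_left_mono order_trans)
qed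

section \<open>Uniform limits and extension from a dense subalgebra\<close>

lemma exists_small_multiple:
  fixes c e :: real
  assumes "c \<ge> 0" "e > 0"
  obtains d where "d > 0" "d * c < e"
proof
  show "e / (1 + c) > 0" using assms by simp
  show "e / (1 + c) * c < e" using assms by (simp add: pos_divide_less_eq distrib_left)
qed

lemma representation_tendsto:
  assumes \<pi>: "representation Y \<pi>" and s: "\<And>k. s k \<in> cfunctions Y" and f: "f \<in> cfunctions Y"
    and lim: "uniform_limit UNIV s f sequentially"
  shows "(\<lambda>k. \<pi> (s k) h) \<longlonglongrightarrow> \<pi> f h"
proof (rule tendstoI)
  fix e :: real assume "e > 0"
  obtain d where d: "d > 0" and "d * norm h < e"
    using exists_small_multiple[of "norm h" e] \<open>e > 0\<close> by auto
  have "eventually (\<lambda>k. \<forall>x\<in>UNIV. dist (s k x) (f x) < d) sequentially"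
    using uniform_limitD[OF lim d] .
  then show "eventually (\<lambda>k. dist (\<pi> (s k) h) (\<pi> f h) < e) sequentially"
  proof eventually_elim
    case (elim k)
    have "norm (\<pi> (\<lambda>x. s k x - f x) h) \<le> d * norm h"
      using elim by (intro representation_contractive[OF \<pi>] cfunctions_diff s f)
        (auto simp: dist_norm intro: less_imp_le)
    then show ?case
      using \<open>d * norm h < e\<close> by (simp add: representation_diff[OF \<pi> s f] dist_norm)
  qed
qed

text \<open>The explicit rate is kept besides uniform convergence because the norm estimates for the
  extended operators need a bound for each single k.\<close>

lemma uniform_approximation:
  fixes f :: "'b \<Rightarrow> complex"
  assumes "\<And>e. e > 0 \<Longrightarrow> \<exists>g\<in>S. \<forall>x. cmod (f x - g x) < e"
  obtains s where "\<And>k. s k \<in> S" "\<And>k x. cmod (f x - s k x) < inverse (Suc k)"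
    "uniform_limit UNIV s f sequentially"
proof -
  have "\<forall>k. \<exists>g\<in>S. \<forall>x. cmod (f x - g x) < inverse (Suc k)" using assms by simp
  then obtain s where s: "\<And>k. s k \<in> S" "\<And>k x. cmod (f x - s k x) < inverse (Suc k)" by metis
  have "uniform_limit UNIV s f sequentially"
  proof (rule uniform_limitI)
    fix e :: real assume "e > 0"
    have "eventually (\<lambda>k. inverse (real (Suc k)) < e) sequentially"
      using order_tendstoD(2)[OF LIMSEQ_inverse_real_of_nat \<open>e > 0\<close>] .
    then show "eventually (\<lambda>k. \<forall>x\<in>UNIV. dist (s k x) (f x) < e) sequentially"
      by eventually_elim (metis dist_norm norm_minus_commute order_less_trans s(2))
  qed
  with s show thesis by (rule that)
qed

lemma representation_eqI:
  assumes "representation Y \<pi>" "representation Y \<rho>" and S: "S \<subseteq> cfunctions Y"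
    and eq: "\<And>f. f \<in> S \<Longrightarrow> \<pi> f = \<rho> f"
    and dense: "\<And>f e. f \<in> cfunctions Y \<Longrightarrow> e > 0 \<Longrightarrow> \<exists>g\<in>S. \<forall>x. cmod (f x - g x) < e"
  shows "\<pi> = \<rho>"
proof (rule PiE_ext)
  show "\<pi> \<in> cfunctions Y \<rightarrow>\<^sub>E bounded_operators" "\<rho> \<in> cfunctions Y \<rightarrow>\<^sub>E bounded_operators"
    using assms(1,2) by (auto simp: representation_def)
  fix f assume f: "f \<in> cfunctions Y"
  obtain s where s: "\<And>k. s k \<in> S" "uniform_limit UNIV s f sequentially"
    using uniform_approximation[OF dense[OF f]] by metis
  show "\<pi> f = \<rho> f"
  proof
    fix h
    have "(\<lambda>k. \<pi> (s k) h) \<longlonglongrightarrow> \<pi> f h" "(\<lambda>k. \<rho> (s k) h) \<longlonglongrightarrow> \<rho> f h"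
      using s S f by (auto intro!: representation_tendsto[OF assms(1)]
          representation_tendsto[OF assms(2)])
    moreover have "(\<lambda>k. \<pi> (s k) h) = (\<lambda>k. \<rho> (s k) h)" using eq s(1) by simp
    ultimately show "\<pi> f h = \<rho> f h" using LIMSEQ_unique by metis
  qed
qed

text \<open>Contractivity turns a uniformly convergent sequence in \<open>S\<close> into a Cauchy
  sequence of vectors for each \<open>h\<close>. The limit is independent of the sequence, so every
  algebraic identity passes to the limit along approximants suited to it.\<close>

lemma representation_dense_extension:
  fixes r :: "('b \<Rightarrow> complex) \<Rightarrow> 'h::complex_hilbert_space \<Rightarrow> 'h"
  assumes "compact_space Y" and S: "S \<subseteq> cfunctions Y"
    and add: "\<And>f g. f \<in> S \<Longrightarrow> g \<in> S \<Longrightarrow> (\<lambda>x. f x + g x) \<in> S"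
      "\<And>f g. f \<in> S \<Longrightarrow> g \<in> S \<Longrightarrow> r (\<lambda>x. f x + g x) = (\<lambda>h. r f h + r g h)"
    and cmult: "\<And>c f. f \<in> S \<Longrightarrow> (\<lambda>x. c * f x) \<in> S"
      "\<And>c f. f \<in> S \<Longrightarrow> r (\<lambda>x. c * f x) = (\<lambda>h. c *\<^sub>C r f h)"
    and mult: "\<And>f g. f \<in> S \<Longrightarrow> g \<in> S \<Longrightarrow> (\<lambda>x. f x * g x) \<in> S"
      "\<And>f g. f \<in> S \<Longrightarrow> g \<in> S \<Longrightarrow> r (\<lambda>x. f x * g x) = r f \<circ> r g"
    and cnj: "\<And>f. f \<in> S \<Longrightarrow> (\<lambda>x. cnj (f x)) \<in> S"
      "\<And>f. f \<in> S \<Longrightarrow> r (\<lambda>x. cnj (f x)) = cadjoint (r f)"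
    and bop: "\<And>f. f \<in> S \<Longrightarrow> r f \<in> bounded_operators"
    and contractive:
      "\<And>f C h. f \<in> S \<Longrightarrow> (\<And>x. cmod (f x) \<le> C) \<Longrightarrow> norm (r f h) \<le> C * norm h"
    and dense: "\<And>f e. f \<in> cfunctions Y \<Longrightarrow> e > 0 \<Longrightarrow> \<exists>g\<in>S. \<forall>x. cmod (f x - g x) < e"
  obtains \<rho> where "representation Y \<rho>" "\<And>f. f \<in> S \<Longrightarrow> \<rho> f = r f"
proof -
  have diff: "(\<lambda>x. f x - g x) \<in> S" "r (\<lambda>x. f x - g x) h = r f h - r g h"
    if "f \<in> S" "g \<in> S" for f g h
    using add[OF that(1) cmult(1)[OF that(2), of "-1"]] cmult(2)[OF that(2), of "-1"]
    by (simp_all add: cscale_minus_one)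
  have null: "(\<lambda>k. r (s k) h - r (t k) h) \<longlonglongrightarrow> 0"
    if s: "\<And>k. s k \<in> S" and t: "\<And>k. t k \<in> S"
      and "uniform_limit UNIV s f sequentially" "uniform_limit UNIV t f sequentially" for s t f h
  proof (rule tendstoI)
    fix e :: real assume "e > 0"
    obtain d where d: "d > 0" and "d * norm h < e"
      using exists_small_multiple[of "norm h" e] \<open>e > 0\<close> by auto
    have "uniform_limit UNIV (\<lambda>k x. s k x - t k x) (\<lambda>x. f x - f x) sequentially"
      using that by (intro uniform_limit_intros)
    from uniform_limitD[OF this d]
    have "eventually (\<lambda>k. \<forall>x. cmod (s k x - t k x) < d) sequentially" by simp
    then show "eventually (\<lambda>k. dist (r (s k) h - r (t k) h) 0 < e) sequentially"
    proof eventually_elim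
      case (elim k)
      have "norm (r (\<lambda>x. s k x - t k x) h) \<le> d * norm h"
        using elim by (intro contractive diff s t) (auto intro: less_imp_le)
      then show ?case using \<open>d * norm h < e\<close> by (simp add: diff s t)
    qed
  qed
  have conv: "convergent (\<lambda>k. r (s k) h)"
    if s: "\<And>k. s k \<in> S" and lim: "uniform_limit UNIV s f sequentially" for s f h
  proof -

    have "Cauchy (\<lambda>k. r (s k) h)"
    proof (rule metric_CauchyI)
      fix e :: real assume "e > 0"
      obtain d where d: "d > 0" and "d * (2 * norm h) < e"
        using exists_small_multiple[of "2 * norm h" e] \<open>e > 0\<close> by auto
      then have "2 * d * norm h < e" by (simp add: mult_ac)
      obtain N where N: "\<And>k x. k \<ge> N \<Longrightarrow> dist (s k x) (f x) < d"
        using uniform_limitD[OF lim d] by (auto simp: eventually_sequentially)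
      have "dist (r (s j) h) (r (s k) h) < e" if "j \<ge> N" "k \<ge> N" for j k
      proof -
        have "cmod (s j x - s k x) \<le> 2 * d" for x
          using N[OF that(1), of x] N[OF that(2), of x]
            dist_triangle2[of "s j x" "s k x" "f x"] by (simp add: dist_norm)
        then have "norm (r (\<lambda>x. s j x - s k x) h) \<le> 2 * d * norm h"
          by (intro contractive diff s)
        then show ?thesis using \<open>2 * d * norm h < e\<close> by (simp add: diff s dist_norm)
      qed
      then show "\<exists>M. \<forall>j\<ge>M. \<forall>k\<ge>M. dist (r (s j) h) (r (s k) h) < e" by blast
    qed
    then show ?thesis by (rule Cauchy_convergent)
  qed
  have "\<exists>s. (\<forall>k. s k \<in> S) \<and> (\<forall>k x. cmod (f x - s k x) < inverse (Suc k)) \<and>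
      uniform_limit UNIV s f sequentially" if "f \<in> cfunctions Y" for f
    using uniform_approximation[OF dense[OF that]] by metis
  then obtain \<sigma> where \<sigma>: "\<And>f k. f \<in> cfunctions Y \<Longrightarrow> \<sigma> f k \<in> S"
      "\<And>f k x. f \<in> cfunctions Y \<Longrightarrow> cmod (f x - \<sigma> f k x) < inverse (Suc k)"
      "\<And>f. f \<in> cfunctions Y \<Longrightarrow> uniform_limit UNIV (\<sigma> f) f sequentially"
    by metis
  define \<rho> where "\<rho> = (\<lambda>f\<in>cfunctions Y. \<lambda>h. lim (\<lambda>k. r (\<sigma> f k) h))"
  \<comment> \<open>Any approximating sequence computes \<open>\<rho> f\<close>, not only the chosen
    \<open>\<sigma> f\<close>; below, sums, multiples and conjugates of the chosen sequences are
    used.\<close>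
  have key: "(\<lambda>k. r (s k) h) \<longlonglongrightarrow> \<rho> f h"
    if "\<And>k. s k \<in> S" "uniform_limit UNIV s f sequentially" "f \<in> cfunctions Y" for s f h
  proof -
    have "(\<lambda>k. r (\<sigma> f k) h) \<longlonglongrightarrow> \<rho> f h"
      using conv[OF \<sigma>(1,3)] that(3) by (simp add: \<rho>_def convergent_LIMSEQ_iff)
    from tendsto_add[OF null[OF that(1) \<sigma>(1) that(2) \<sigma>(3), where h = h] this]
    show ?thesis using that(3) by simp
  qed
  have key\<sigma>: "(\<lambda>k. r (\<sigma> f k) h) \<longlonglongrightarrow> \<rho> f h" if "f \<in> cfunctions Y" for f h
    by (rule key[OF \<sigma>(1)[OF that] \<sigma>(3)[OF that] that])
  have ext: "\<rho> f = r f" if "f \<in> S" for f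
  proof
    fix h
    have "(\<lambda>k. r f h) \<longlonglongrightarrow> \<rho> f h"
      by (rule key[where s = "\<lambda>k. f"]) (use that S in \<open>auto intro: uniform_limit_const\<close>)
    then show "\<rho> f h = r f h" by (simp add: LIMSEQ_const_iff)
  qed
  have contr: "norm (\<rho> f h) \<le> C * norm h"
    if f: "f \<in> cfunctions Y" and C: "\<And>x. cmod (f x) \<le> C" for f C h
  proof (rule LIMSEQ_le)
    show "(\<lambda>k. norm (r (\<sigma> f k) h)) \<longlonglongrightarrow> norm (\<rho> f h)"
      by (intro tendsto_norm key\<sigma> f)
    show "(\<lambda>k. (C + inverse (Suc k)) * norm h) \<longlonglongrightarrow> C * norm h"
    proof -
      have "(\<lambda>k. (C + inverse (Suc k)) * norm h) \<longlonglongrightarrow> (C + 0) * norm h"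
        by (intro tendsto_mult tendsto_add tendsto_const LIMSEQ_inverse_real_of_nat)
      then show ?thesis by (simp only: add_0_right)
    qed
    have "norm (r (\<sigma> f k) h) \<le> (C + inverse (Suc k)) * norm h" for k
    proof (rule contractive)
      show "\<sigma> f k \<in> S" by (rule \<sigma>(1)[OF f])
      show "cmod (\<sigma> f k x) \<le> C + inverse (Suc k)" for x
        using \<sigma>(2)[OF f, of x k] C[of x] norm_triangle_sub[of "\<sigma> f k x" "f x"]
        unfolding norm_minus_commute[of "\<sigma> f k x" "f x"] by linarith
    qed
    then show "\<exists>N. \<forall>n\<ge>N. norm (r (\<sigma> f n) h) \<le> (C + inverse (Suc n)) * norm h" by blast
  qed
  \<comment> \<open>Uniform convergence passes to products only for bounded limits; this is where
    compactness of \<open>Y\<close> enters.\<close>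
  have bounded_image: "bounded (f ` UNIV)" if f: "f \<in> cfunctions Y" for f :: "'b \<Rightarrow> complex"
  proof -
    obtain B where "\<And>x. cmod (f x) \<le> B" using cfunctions_bounded[OF assms(1) f] by blast
    then show ?thesis by (auto simp: bounded_iff)
  qed
  have \<rho>_add: "\<rho> (\<lambda>x. f x + g x) = (\<lambda>h. \<rho> f h + \<rho> g h)"
    if f: "f \<in> cfunctions Y" and g: "g \<in> cfunctions Y" for f g
  proof
    fix h
    have "(\<lambda>k. r (\<lambda>x. \<sigma> f k x + \<sigma> g k x) h) \<longlonglongrightarrow> \<rho> (\<lambda>x. f x + g x) h"
      by (rule key[where s = "\<lambda>k x. \<sigma> f k x + \<sigma> g k x"])
        (rule add \<sigma> f g cfunctions_add uniform_limit_add)+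
    moreover have "(\<lambda>k. r (\<lambda>x. \<sigma> f k x + \<sigma> g k x) h) \<longlonglongrightarrow> \<rho> f h + \<rho> g h"
      using tendsto_add[OF key\<sigma>[OF f] key\<sigma>[OF g]] by (simp add: add(2) \<sigma>(1) f g)
    ultimately show "\<rho> (\<lambda>x. f x + g x) h = \<rho> f h + \<rho> g h" by (rule LIMSEQ_unique)
  qed
  have \<rho>_cmult: "\<rho> (\<lambda>x. c * f x) = (\<lambda>h. c *\<^sub>C \<rho> f h)" if f: "f \<in> cfunctions Y" for c f
  proof
    fix h
    have "(\<lambda>k. r (\<lambda>x. c * \<sigma> f k x) h) \<longlonglongrightarrow> \<rho> (\<lambda>x. c * f x) h"
      by (rule key[where s = "\<lambda>k x. c * \<sigma> f k x"])
        (rule cmult \<sigma> f cfunctions_cmult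
          bounded_linear.uniform_limit[OF bounded_linear_mult_right])+
    moreover have "(\<lambda>k. r (\<lambda>x. c * \<sigma> f k x) h) \<longlonglongrightarrow> c *\<^sub>C \<rho> f h"
      using bounded_linear.tendsto[OF bounded_linear_cscale key\<sigma>[OF f]]
      by (simp add: cmult(2) \<sigma>(1) f)
    ultimately show "\<rho> (\<lambda>x. c * f x) h = c *\<^sub>C \<rho> f h" by (rule LIMSEQ_unique)
  qed
  have \<rho>_bop: "\<rho> f \<in> bounded_operators" if f: "f \<in> cfunctions Y" for f
  proof -
    obtain B where B: "\<And>x. cmod (f x) \<le> B" using cfunctions_bounded[OF assms(1) f] by blast
    show ?thesis
    proof (rule bounded_operatorsI)
      show "norm (\<rho> f x) \<le> norm x * B" for x
        using contr[OF f B, of x] by (simp add: mult.commute)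
      show "\<rho> f (x + y) = \<rho> f x + \<rho> f y" for x y
        using tendsto_add[OF key\<sigma>[OF f, of x] key\<sigma>[OF f, of y]] key\<sigma>[OF f, of "x + y"]
        by (simp add: bounded_operatorsD(3)[OF bop[OF \<sigma>(1)[OF f]]] LIMSEQ_unique)
      show "\<rho> f (c *\<^sub>C x) = c *\<^sub>C \<rho> f x" for c x
        using bounded_linear.tendsto[OF bounded_linear_cscale key\<sigma>[OF f, of x], of c]
          key\<sigma>[OF f, of "c *\<^sub>C x"]
        by (simp add: bounded_operatorsD(2)[OF bop[OF \<sigma>(1)[OF f]]] LIMSEQ_unique)
    qed
  qed
  have \<rho>_cnj: "\<rho> (\<lambda>x. cnj (f x)) = cadjoint (\<rho> f)" if f: "f \<in> cfunctions Y" for f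
  proof (rule cadjoint_eqI[symmetric])
    fix x y
    have "(\<lambda>k. r (\<lambda>x. cnj (\<sigma> f k x)) y) \<longlonglongrightarrow> \<rho> (\<lambda>x. cnj (f x)) y"
      by (rule key[where s = "\<lambda>k x. cnj (\<sigma> f k x)"])
        (rule cnj \<sigma> f cfunctions_cnj bounded_linear.uniform_limit[OF bounded_linear_cnj])+
    from tendsto_cinner_right[OF this]
    have "(\<lambda>k. cinner (r (\<sigma> f k) x) y) \<longlonglongrightarrow> cinner x (\<rho> (\<lambda>x. cnj (f x)) y)"
      by (simp add: cnj(2) \<sigma>(1) f cinner_cadjoint_right bop)
    moreover have "(\<lambda>k. cinner (r (\<sigma> f k) x) y) \<longlonglongrightarrow> cinner (\<rho> f x) y"
      by (intro tendsto_cinner key\<sigma> f)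
    ultimately show "cinner (\<rho> f x) y = cinner x (\<rho> (\<lambda>x. cnj (f x)) y)"
      using LIMSEQ_unique by blast
  qed
  \<comment> \<open>Convergence is only pointwise in \<open>h\<close>, so the two factors are not
    varied together: the right factor stays in \<open>S\<close> here and is approximated afterwards
    with the norm bound \<open>contr\<close>.\<close>
  have \<rho>_mult_right: "\<rho> (\<lambda>x. f x * g x) = \<rho> f \<circ> r g" if f: "f \<in> cfunctions Y" and g: "g \<in> S" for f g
  proof
    fix h
    have "(\<lambda>k. r (\<lambda>x. \<sigma> f k x * g x) h) \<longlonglongrightarrow> \<rho> (\<lambda>x. f x * g x) h"
      by (rule key[where s = "\<lambda>k x. \<sigma> f k x * g x"])
        (use g S in \<open>auto intro!: mult \<sigma> f cfunctions_mult uniform_lim_mult uniform_limit_const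
          bounded_image\<close>)
    moreover have "(\<lambda>k. r (\<lambda>x. \<sigma> f k x * g x) h) \<longlonglongrightarrow> \<rho> f (r g h)"
      using key\<sigma>[OF f, of "r g h"] by (simp add: mult(2) \<sigma>(1) f g)
    ultimately show "\<rho> (\<lambda>x. f x * g x) h = (\<rho> f \<circ> r g) h" using LIMSEQ_unique by fastforce
  qed
  have \<rho>_mult: "\<rho> (\<lambda>x. f x * g x) = \<rho> f \<circ> \<rho> g"
    if f: "f \<in> cfunctions Y" and g: "g \<in> cfunctions Y" for f g
  proof
    fix h
    obtain B where B: "\<And>x. cmod (f x) \<le> B" using cfunctions_bounded[OF assms(1) f] by blast
    have "(\<lambda>k. \<rho> f (r (\<sigma> g k) h) - \<rho> (\<lambda>x. f x * g x) h) \<longlonglongrightarrow> 0"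
    proof (rule tendsto_norm_zero_cancel, rule Lim_null_comparison)
      have "norm (\<rho> f (r (\<sigma> g k) h) - \<rho> (\<lambda>x. f x * g x) h)
          \<le> (B * inverse (Suc k)) * norm h" for k
      proof -
        have gk: "\<sigma> g k \<in> S" "\<sigma> g k \<in> cfunctions Y" using \<sigma>(1)[OF g] S by auto
        \<comment> \<open>The difference is spelled as a sum with a multiple by -1, so that
          \<open>\<rho>_add\<close> and \<open>\<rho>_cmult\<close> apply.\<close>
        have "\<rho> (\<lambda>x. f x * \<sigma> g k x + (-1) * (f x * g x)) h =
            \<rho> f (r (\<sigma> g k) h) - \<rho> (\<lambda>x. f x * g x) h"
          by (simp only: \<rho>_add[OF cfunctions_mult[OF f gk(2)] cfunctions_cmult[OF cfunctions_mult[OF f g]]]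
              \<rho>_mult_right[OF f gk(1)] \<rho>_cmult[OF cfunctions_mult[OF f g]]
              o_apply cscale_minus_one add_uminus_conv_diff)
        moreover have "norm (\<rho> (\<lambda>x. f x * \<sigma> g k x + (-1) * (f x * g x)) h)
            \<le> (B * inverse (Suc k)) * norm h"
        proof (rule contr)
          show "(\<lambda>x. f x * \<sigma> g k x + (-1) * (f x * g x)) \<in> cfunctions Y"
            by (intro cfunctions_add cfunctions_mult cfunctions_cmult f g gk(2))
          fix x
          have "cmod (f x * \<sigma> g k x + (-1) * (f x * g x)) = cmod (f x) * cmod (g x - \<sigma> g k x)"
            by (simp add: norm_minus_commute right_diff_distrib flip: norm_mult)
          also have "\<dots> \<le> B * inverse (Suc k)"
            using B[of x] \<sigma>(2)[OF g, of x k] by (intro mult_mono') auto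
          finally show "cmod (f x * \<sigma> g k x + (-1) * (f x * g x)) \<le> B * inverse (Suc k)" .
        qed
        ultimately show ?thesis by simp
      qed
      then show "eventually (\<lambda>k. norm (norm (\<rho> f (r (\<sigma> g k) h) - \<rho> (\<lambda>x. f x * g x) h))
          \<le> (B * inverse (Suc k)) * norm h) sequentially" by simp
      show "(\<lambda>k. (B * inverse (Suc k)) * norm h) \<longlonglongrightarrow> 0"
      proof -
        have "(\<lambda>k. (B * inverse (Suc k)) * norm h) \<longlonglongrightarrow> (B * 0) * norm h"
          by (intro tendsto_mult tendsto_const LIMSEQ_inverse_real_of_nat)
        then show ?thesis by (simp only: mult_zero_right mult_zero_left)
      qed
    qed
    moreover have "(\<lambda>k. \<rho> f (r (\<sigma> g k) h) - \<rho> (\<lambda>x. f x * g x) h)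
        \<longlonglongrightarrow> \<rho> f (\<rho> g h) - \<rho> (\<lambda>x. f x * g x) h"
      by (intro tendsto_intros bounded_linear.tendsto[OF bounded_operatorsD(1)[OF \<rho>_bop[OF f]]]
          key\<sigma> g)
    ultimately show "\<rho> (\<lambda>x. f x * g x) h = (\<rho> f \<circ> \<rho> g) h"
      using LIMSEQ_unique by fastforce
  qed
  have "representation Y \<rho>"
    unfolding representation_def
  proof (intro conjI ballI allI)
    show "\<rho> \<in> cfunctions Y \<rightarrow>\<^sub>E bounded_operators"
      using \<rho>_bop by (intro PiE_I) (simp_all add: \<rho>_def)
  qed (fact \<rho>_add \<rho>_cmult \<rho>_mult \<rho>_cnj)+
  then show thesis using ext by (rule that)
qed

section \<open>The Stone--Weierstrass theorem for abstract compact spaces\<close>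

text \<open>The function type carries the product topology but is an instance of \<^class>\<open>t2_space\<close> only for
  countable index types, so that a copy of it is needed.\<close>

typedef 'i real_power = "UNIV :: ('i \<Rightarrow> real) set"
  by simp

instantiation real_power :: (type) t2_space
begin

definition open_real_power :: "'a real_power set \<Rightarrow> bool"
  where "open_real_power U \<longleftrightarrow> open (Abs_real_power -` U)"

instance
proof
  show "open (UNIV :: 'a real_power set)" by (simp add: open_real_power_def)
  show "open (S \<inter> T)" if "open S" "open T" for S T :: "'a real_power set"
    using that by (simp add: open_real_power_def open_Int)
  show "open (\<Union>K)" if "\<forall>S\<in>K. open S" for K :: "'a real_power set set"
    using that by (auto simp: open_real_power_def vimage_Union)
  fix f g :: "'a real_power" assume "f \<noteq> g"
  then obtain i where i: "Rep_real_power f i \<noteq> Rep_real_power g i"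
    by (metis Rep_real_power_inject ext)
  obtain U V where UV: "open U" "open V" "Rep_real_power f i \<in> U" "Rep_real_power g i \<in> V"
      "U \<inter> V = {}"
    using hausdorff[OF i] by blast
  have "open ((\<lambda>h. Rep_real_power h i) -` W :: 'a real_power set)" if "open W" for W
  proof -
    have "open ((\<lambda>h::'a \<Rightarrow> real. h i) -` W)"
      using that continuous_on_subset[OF continuous_on_product_coordinates[of i]] by (auto intro: open_vimage)
    then show ?thesis
      by (simp add: open_real_power_def vimage_def Abs_real_power_inverse)
  qed
  with UV show "\<exists>U V. open U \<and> open V \<and> f \<in> U \<and> g \<in> V \<and> U \<inter> V = {}"
    by (intro exI[of _ "(\<lambda>h. Rep_real_power h i) -` U"] exI[of _ "(\<lambda>h. Rep_real_power h i) -` V"])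
      auto
qed

end

text \<open>The functions of \<open>R\<close> embed the space into a power of the reals, where the type-class
  version of the theorem applies.\<close>

lemma Stone_Weierstrass_compact_space:
  fixes R :: "('b \<Rightarrow> real) set"
  assumes Y: "compact_space Y" and cont: "\<And>f. f \<in> R \<Longrightarrow> continuous_map Y euclideanreal f"
    and add: "\<And>f g. f \<in> R \<Longrightarrow> g \<in> R \<Longrightarrow> (\<lambda>x. f x + g x) \<in> R"
    and mult: "\<And>f g. f \<in> R \<Longrightarrow> g \<in> R \<Longrightarrow> (\<lambda>x. f x * g x) \<in> R"
    and const: "\<And>c. (\<lambda>x. c) \<in> R"
    and sep: "\<And>x y. x \<in> topspace Y \<Longrightarrow> y \<in> topspace Y \<Longrightarrow> x \<noteq> y \<Longrightarrow> \<exists>f\<in>R. f x \<noteq> f y"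
    and f: "continuous_map Y euclideanreal f" and e: "e > 0"
  shows "\<exists>g\<in>R. \<forall>x\<in>topspace Y. \<bar>f x - g x\<bar> < e"
proof -
  \<comment> \<open>The index set of the power has to be a type, so all real functions serve as
    indices and those outside \<open>R\<close> contribute the constant 0.\<close>
  define F where "F x = (\<lambda>f. if f \<in> R then f x else 0)" for x
  define G where "G x = Abs_real_power (F x)" for x
  define K where "K = G ` topspace Y"
  have "continuous_map Y (product_topology (\<lambda>_. euclideanreal) UNIV) F"
    unfolding continuous_map_componentwise_UNIV F_def
  proof
    show "continuous_map Y euclideanreal (\<lambda>x. if k \<in> R then k x else 0)" for k
      by (cases "k \<in> R") (simp_all add: cont)
  qed
  then have F: "continuous_map Y euclidean F" by (simp add: euclidean_product_topology)
  have G: "continuous_map Y euclidean G"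
  proof -
    have "openin Y {x \<in> topspace Y. G x \<in> U}" if "open U" for U
    proof -
      have "openin Y {x \<in> topspace Y. F x \<in> Abs_real_power -` U}"
        using that by (intro openin_continuous_map_preimage[OF F]) (simp add: open_real_power_def)
      then show ?thesis by (simp add: G_def)
    qed
    then show ?thesis by (simp add: continuous_map_def)
  qed
  have GK: "continuous_map Y (top_of_set K) G"
    using G by (simp add: continuous_map_in_subtopology K_def image_subset_iff_funcset[symmetric])
  have "compact K"
    using image_compactin[OF Y[unfolded compact_space_def] G] by (simp add: K_def)
  have "inj_on G (topspace Y)"
  proof (rule inj_onI)
    fix x y assume xy: "x \<in> topspace Y" "y \<in> topspace Y" "G x = G y"
    have "F x = F y" using xy(3) by (simp add: G_def Abs_real_power_inject)
    have "f x = f y" if "f \<in> R" for f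
      using fun_cong[OF \<open>F x = F y\<close>, of f] that by (simp add: F_def)
    then show "x = y" using sep xy(1,2) by blast
  qed
  have "Hausdorff_space (euclidean :: ('b \<Rightarrow> real) real_power topology) \<or> True" by simp
  have "Hausdorff_space (euclidean :: ('b \<Rightarrow> real) real_power topology)"
    unfolding Hausdorff_space_def disjnt_def
  proof (intro allI impI)
    fix x y :: "('b \<Rightarrow> real) real_power"
    assume "x \<in> topspace euclidean \<and> y \<in> topspace euclidean \<and> x \<noteq> y"
    then have "x \<noteq> y" by blast
    obtain U V where "open U" "open V" "x \<in> U" "y \<in> V" "U \<inter> V = {}"
      using hausdorff[OF \<open>x \<noteq> y\<close>] by blast
    then show "\<exists>U V. openin euclidean U \<and> openin euclidean V \<and> x \<in> U \<and> y \<in> V \<and> U \<inter> V = {}"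
      by (intro exI[of _ U] exI[of _ V]) simp
  qed
  then have "Hausdorff_space (top_of_set K)" by (rule Hausdorff_space_subtopology)
  \<comment> \<open>A continuous map from a compact space onto a Hausdorff space is a quotient map,
    so functions on \<open>K\<close> may be tested for continuity after composition with
    \<open>G\<close>.\<close>
  then have quot: "quotient_map Y (top_of_set K) G"
    by (intro T1_Spaces.continuous_imp_quotient_map[OF GK Y]) (simp_all add: K_def)
  define inv where "inv = inv_into (topspace Y) G"
  have inv: "inv (G x) = x" if "x \<in> topspace Y" for x
    using that \<open>inj_on G (topspace Y)\<close> by (simp add: inv_def)
  have lift: "continuous_on K (\<lambda>z. u (inv z))" if "continuous_map Y euclideanreal u" for u
  proof -
    have "continuous_map Y euclideanreal ((\<lambda>z. u (inv z)) \<circ> G)"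
      by (rule continuous_map_eq[OF that]) (simp add: inv)
    from continuous_compose_quotient_map[OF quot this] show ?thesis
      by (simp add: continuous_map_iff_continuous)
  qed
  interpret function_ring_on "(\<lambda>u z. u (inv z)) ` R" K
  proof
    show "\<exists>f\<in>(\<lambda>u z. u (inv z)) ` R. f x \<noteq> f y" if "x \<in> K" "y \<in> K" "x \<noteq> y" for x y
    proof -
      obtain x' y' where xy: "x' \<in> topspace Y" "y' \<in> topspace Y" "x = G x'" "y = G y'"
        using \<open>x \<in> K\<close> \<open>y \<in> K\<close> by (auto simp: K_def)
      then have "x' \<noteq> y'" using \<open>x \<noteq> y\<close> by auto
      then obtain u where "u \<in> R" "u x' \<noteq> u y'" using sep xy by blast
      then show ?thesis using xy by (auto simp: inv)
    qed
  next
    fix u v assume "u \<in> (\<lambda>u z. u (inv z)) ` R" "v \<in> (\<lambda>u z. u (inv z)) ` R"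
    then obtain u' v' where uv: "u' \<in> R" "v' \<in> R" "u = (\<lambda>z. u' (inv z))" "v = (\<lambda>z. v' (inv z))"
      by blast
    show "(\<lambda>x. u x + v x) \<in> (\<lambda>u z. u (inv z)) ` R"
      using add[OF uv(1,2)] unfolding uv(3,4) by (rule rev_image_eqI) (rule refl)
    show "(\<lambda>x. u x * v x) \<in> (\<lambda>u z. u (inv z)) ` R"
      using mult[OF uv(1,2)] unfolding uv(3,4) by (rule rev_image_eqI) (rule refl)
  next
    show "(\<lambda>_. c) \<in> (\<lambda>u z. u (inv z)) ` R" for c
      using const[of c] by (rule rev_image_eqI) (rule refl)
    show "continuous_on K u" if "u \<in> (\<lambda>u z. u (inv z)) ` R" for u
      using that lift[OF cont] by blast
  qed (rule \<open>compact K\<close>)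
  obtain g where "g \<in> R" "\<forall>z\<in>K. \<bar>f (inv z) - g (inv z)\<bar> < e"
    using Stone_Weierstrass_basic[OF lift[OF f] e] by auto
  then have "\<forall>x\<in>topspace Y. \<bar>f x - g x\<bar> < e" by (auto simp: K_def inv)
  with \<open>g \<in> R\<close> show ?thesis by blast
qed

text \<open>Closure under conjugation puts the real and imaginary parts of members of
  \<open>S\<close> into a real algebra, which therefore still separates points. Each part of
  \<open>f\<close> is approximated to within e / 2.\<close>

lemma Stone_Weierstrass_cfunctions:
  assumes Y: "compact_space Y" and S: "S \<subseteq> cfunctions Y"
    and add: "\<And>f g. f \<in> S \<Longrightarrow> g \<in> S \<Longrightarrow> (\<lambda>x. f x + g x) \<in> S"
    and mult: "\<And>f g. f \<in> S \<Longrightarrow> g \<in> S \<Longrightarrow> (\<lambda>x. f x * g x) \<in> S"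
    and cmult: "\<And>c f. f \<in> S \<Longrightarrow> (\<lambda>x. c * f x) \<in> S"
    and cnj: "\<And>f. f \<in> S \<Longrightarrow> (\<lambda>x. cnj (f x)) \<in> S"
    and one: "indicator (topspace Y) \<in> S"
    and sep: "\<And>x y. x \<in> topspace Y \<Longrightarrow> y \<in> topspace Y \<Longrightarrow> x \<noteq> y \<Longrightarrow> \<exists>f\<in>S. f x \<noteq> f y"
    and f: "f \<in> cfunctions Y" and e: "e > 0"
  shows "\<exists>g\<in>S. \<forall>x. cmod (f x - g x) < e"
proof -
  \<comment> \<open>Members of \<open>S\<close> vanish off the carrier while real constants do not;
    cutting off by zero makes the constants correspond to multiples of the indicator in
    \<open>one\<close>.\<close>
  define ext where "ext u = (\<lambda>x. if x \<in> topspace Y then complex_of_real (u x) else 0)" for u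
  define R where "R = {u. ext u \<in> S}"
  have S0: "g x = 0" if "g \<in> S" "x \<notin> topspace Y" for g x
    using that S by (auto simp: cfunctions_def)
  have cont_Re: "continuous_map Y euclideanreal (\<lambda>x. Re (g x))"
    and cont_Im: "continuous_map Y euclideanreal (\<lambda>x. Im (g x))" if "g \<in> cfunctions Y" for g
    using that by (simp_all add: cfunctions_def continuous_map_atin tendsto_Re tendsto_Im)
  have Re_R: "(\<lambda>x. Re (g x)) \<in> R" if "g \<in> S" for g
  proof -
    have "ext (\<lambda>x. Re (g x)) = (\<lambda>x. (1/2) * (g x + cnj (g x)))"
      by (auto simp: ext_def complex_add_cnj S0[OF that])
    then show ?thesis
      using cmult[OF add[OF that cnj[OF that]], of "1/2"] by (simp only: R_def mem_Collect_eq)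
  qed
  have Im_R: "(\<lambda>x. Im (g x)) \<in> R" if "g \<in> S" for g
    \<comment> \<open>The imaginary part of z is the real part of -i z.\<close>
    using Re_R[OF cmult[OF that, of "- \<i>"]] by simp
  have approx: "\<exists>g\<in>R. \<forall>x\<in>topspace Y. \<bar>u x - g x\<bar> < e / 2" if "continuous_map Y euclideanreal u" for u
  proof (rule Stone_Weierstrass_compact_space[OF Y _ _ _ _ _ that])
    fix u v assume uv: "u \<in> R" "v \<in> R"
    have "ext (\<lambda>x. u x + v x) = (\<lambda>x. ext u x + ext v x)"
      "ext (\<lambda>x. u x * v x) = (\<lambda>x. ext u x * ext v x)"
      by (auto simp: ext_def)
    then show "(\<lambda>x. u x + v x) \<in> R" "(\<lambda>x. u x * v x) \<in> R"
      using uv add[of "ext u" "ext v"] mult[of "ext u" "ext v"]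
      by (simp_all only: R_def mem_Collect_eq)
  next
    fix u assume "u \<in> R"
    then have "ext u \<in> cfunctions Y" using S by (auto simp: R_def)
    from cont_Re[OF this] show "continuous_map Y euclideanreal u"
      by (rule continuous_map_eq) (simp only: ext_def if_True Re_complex_of_real)
  next
    fix c
    have "ext (\<lambda>x. c) = (\<lambda>x. complex_of_real c * indicator (topspace Y) x)"
      by (auto simp: ext_def indicator_def)
    then show "(\<lambda>x. c) \<in> R" using cmult[OF one, of "complex_of_real c"]
      by (simp only: R_def mem_Collect_eq)
  next
    fix x y assume "x \<in> topspace Y" "y \<in> topspace Y" "x \<noteq> y"
    then obtain g where "g \<in> S" "g x \<noteq> g y" using sep by blast
    then have "Re (g x) \<noteq> Re (g y) \<or> Im (g x) \<noteq> Im (g y)" by (simp add: complex_eq_iff)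
    then show "\<exists>f\<in>R. f x \<noteq> f y"
    proof
      assume "Re (g x) \<noteq> Re (g y)"
      then show ?thesis by (rule bexI[OF _ Re_R[OF \<open>g \<in> S\<close>]])
    next
      assume "Im (g x) \<noteq> Im (g y)"
      then show ?thesis by (rule bexI[OF _ Im_R[OF \<open>g \<in> S\<close>]])
    qed
  qed (use e in simp)
  obtain u where u: "u \<in> R" "\<And>x. x \<in> topspace Y \<Longrightarrow> \<bar>Re (f x) - u x\<bar> < e / 2"
    using approx[OF cont_Re[OF f]] by blast
  obtain v where v: "v \<in> R" "\<And>x. x \<in> topspace Y \<Longrightarrow> \<bar>Im (f x) - v x\<bar> < e / 2"
    using approx[OF cont_Im[OF f]] by blast
  have approx_S: "(\<lambda>x. ext u x + \<i> * ext v x) \<in> S"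
    using u(1) v(1) by (intro add[of "ext u" "\<lambda>x. \<i> * ext v x"] cmult[of "ext v"]) (simp_all only: R_def mem_Collect_eq)
  have approx_lt: "cmod (f x - (ext u x + \<i> * ext v x)) < e" for x
  proof (cases "x \<in> topspace Y")
    case True
    have "cmod (f x - (ext u x + \<i> * ext v x)) \<le> \<bar>Re (f x) - u x\<bar> + \<bar>Im (f x) - v x\<bar>"
      using cmod_le[of "f x - (ext u x + \<i> * ext v x)"] True by (simp add: ext_def)
    then show ?thesis using u(2)[OF True] v(2)[OF True] by simp
  next
    case False
    then show ?thesis using f e by (simp add: ext_def cfunctions_def)
  qed
  show ?thesis by (rule bexI[OF _ approx_S]) (rule allI, rule approx_lt)
qed

section \<open>The reversible extension of a surjective partial map\<close>

lemma image_closedin: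
  assumes "compact_space X" "Hausdorff_space X" "closedin X D1"
    "continuous_map (subtopology X D1) X \<alpha>"
  shows "closedin X (\<alpha> ` D1)"
proof -
  have "compactin X D1" using closedin_compact_space[OF assms(1,3)] .
  then have "compactin (subtopology X D1) D1" by (simp add: compactin_subtopology)
  then have "compactin X (\<alpha> ` D1)" using assms(4) by (rule image_compactin)
  then show ?thesis by (rule compactin_imp_closedin[OF assms(2)])
qed

text \<open>The image of \<alpha> is open by hypothesis and closed by compactness, so the indicator
  of its complement is continuous; \<open>endo\<close> sends it to 0.\<close>

lemma inj_endo_imp_surj:
  assumes "compact_space X" "Hausdorff_space X" "closedin X D1"
    and cont: "continuous_map (subtopology X D1) X \<alpha>" and op: "openin X (\<alpha> ` D1)"
    and inj: "inj_on (endo D1 \<alpha>) (cfunctions X)"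
  shows "\<alpha> ` D1 = topspace X"
proof -
  let ?K = "topspace X - \<alpha> ` D1"
  have "closedin X (\<alpha> ` D1)" using assms(1-4) by (rule image_closedin)
  then have K: "indicator ?K \<in> cfunctions X"
    using op by (intro cfunctions_indicator openin_diff closedin_diff) auto
  have zero: "(\<lambda>x. 0) \<in> cfunctions X" by (simp add: cfunctions_def)
  have "endo D1 \<alpha> (indicator ?K) = endo D1 \<alpha> (\<lambda>x. 0)"
    by (auto simp: endo_def indicator_def)
  then have "indicator ?K = (\<lambda>x. 0 :: complex)" by (rule inj_onD[OF inj _ K zero])
  then have "indicator ?K x = (0::complex)" for x by simp
  then have "?K = {}" by (metis (no_types, lifting) equals0I indicator_simps(1) zero_neq_one)
  then show ?thesis using openin_subset[OF op] by blast
qed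

locale onto_partial_map =
  fixes X :: "'a topology" and D1 :: "'a set" and \<alpha> :: "'a \<Rightarrow> 'a"
  assumes compact: "compact_space X" and Hausdorff: "Hausdorff_space X"
    and D1_open: "openin X D1" and D1_closed: "closedin X D1"
    and continuous: "continuous_map (subtopology X D1) X \<alpha>"
    and onto: "\<alpha> ` D1 = topspace X"
begin

abbreviation "Xt \<equiv> ext_space X D1 \<alpha>"
abbreviation "D1t \<equiv> ext_preimage X D1 \<alpha> D1"

text \<open>Backward orbits of \<alpha>. Each condition concerns one coordinate or two neighbouring
  ones, which suits the compactness proof; membership of \<open>x n\<close> in
  \<open>iter_dom n\<close> follows by induction.\<close>

definition thread :: "(nat \<Rightarrow> 'a) \<Rightarrow> bool"
  where "thread x \<longleftrightarrow>
    (\<forall>n. x n \<in> topspace X) \<and> (\<forall>n. x (Suc n) \<in> D1 \<and> \<alpha> (x (Suc n)) = x n)"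

lemma D1_subset: "D1 \<subseteq> topspace X" using openin_subset[OF D1_open] .

lemma iter_dom_subset: "iter_dom X D1 \<alpha> n \<subseteq> topspace X"
  using D1_subset by (cases n) auto

text \<open>A finite sequence would have to end outside the image of \<alpha>, which is the whole
  space.\<close>

lemma ext_fin_empty: "ext_fin X D1 \<alpha> N = {}"
  unfolding ext_fin_def onto using iter_dom_subset[of N] by blast

lemma ext_inf_eq: "ext_inf X D1 \<alpha> = {(\<lambda>n. Some (x n)) | x. thread x}"
proof -
  have "(\<forall>n. x n \<in> iter_dom X D1 \<alpha> n) \<and> (\<forall>n\<ge>1. \<alpha> (x n) = x (n - 1)) \<longleftrightarrow> thread x" for x
  proof
    assume x: "(\<forall>n. x n \<in> iter_dom X D1 \<alpha> n) \<and> (\<forall>n\<ge>1. \<alpha> (x n) = x (n - 1))"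
    have "x n \<in> topspace X" for n using x iter_dom_subset[of n] by blast
    moreover have "x (Suc n) \<in> D1" for n
    proof -
      have "x (Suc n) \<in> iter_dom X D1 \<alpha> (Suc n)" using x by blast
      then show ?thesis by simp
    qed
    moreover have "\<alpha> (x (Suc n)) = x n" for n
    proof -
      show ?thesis using spec[OF conjunct2[OF x], of "Suc n"] by simp
    qed
    ultimately show "thread x" by (simp add: thread_def)
  next
    assume x: "thread x"
    have "x n \<in> iter_dom X D1 \<alpha> n" for n
      by (induction n) (use x in \<open>auto simp: thread_def\<close>)
    moreover have "\<alpha> (x n) = x (n - 1)" if "n \<ge> 1" for n
      using x that by (cases n) (auto simp: thread_def)
    ultimately show "(\<forall>n. x n \<in> iter_dom X D1 \<alpha> n) \<and> (\<forall>n\<ge>1. \<alpha> (x n) = x (n - 1))" by blast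
  qed
  then show ?thesis unfolding ext_inf_def by simp
qed

section \<open>Topology of the space of threads\<close>

lemma ext_space_eq:
  "Xt = subtopology (product_topology (\<lambda>_. adjoin_point X) UNIV) (ext_inf X D1 \<alpha>)"
  unfolding ext_space_def by (simp add: ext_fin_empty)

lemma continuous_map_Some: "continuous_map X (adjoin_point X) Some"
proof -
  have top: "topspace (adjoin_point X) = insert None (Some ` topspace X)"
  proof
    show "topspace (adjoin_point X) \<subseteq> insert None (Some ` topspace X)"
      using openin_topspace[of "adjoin_point X"] unfolding openin_adjoin_point by blast
    have "{x. Some x \<in> insert None (Some ` topspace X)} = topspace X" by auto
    then have "openin (adjoin_point X) (insert None (Some ` topspace X))"
      unfolding openin_adjoin_point by simp
    then show "insert None (Some ` topspace X) \<subseteq> topspace (adjoin_point X)"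
      by (rule openin_subset)
  qed
  have "openin X {x \<in> topspace X. Some x \<in> U}" if "openin (adjoin_point X) U" for U
  proof -
    have U: "openin X {x. Some x \<in> U}" using that unfolding openin_adjoin_point by blast
    then have "{x \<in> topspace X. Some x \<in> U} = {x. Some x \<in> U}"
      using openin_subset by fastforce
    with U show ?thesis by simp
  qed
  then show ?thesis unfolding continuous_map_def top by blast
qed

lemma openin_Some_image: "openin X V \<Longrightarrow> openin (adjoin_point X) (Some ` V)"
  using openin_subset[of X V] by (auto simp: openin_adjoin_point image_iff)

lemma topspace_ext: "topspace Xt = {(\<lambda>n. Some (x n)) | x. thread x}"
proof -
  have "(\<lambda>n. Some (x n)) \<in> topspace (product_topology (\<lambda>_. adjoin_point X) UNIV)"
    if "thread x" for x
    using that continuous_map_image_subset_topspace[OF continuous_map_Some]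
    by (auto simp: thread_def)
  then show ?thesis unfolding ext_space_eq ext_inf_eq topspace_subtopology by blast
qed

text \<open>Threads form a closed subset of a power of \<open>X\<close>, which is compact by
  Tychonoff; applying \<open>Some\<close> in every coordinate is continuous and carries them onto
  the extended space.\<close>

lemma compact_ext: "compact_space Xt"
proof -
  let ?P = "product_topology (\<lambda>_::nat. X) UNIV"
  \<comment> \<open>\<alpha> is continuous on \<open>D1\<close> only, so the equation in
    \<open>C n\<close> is closed relative to \<open>Z n\<close>, which is itself closed because
    \<open>D1\<close> is.\<close>
  define Z where "Z n = {x \<in> topspace ?P. x (Suc n) \<in> D1}" for n
  define C where "C n = {x \<in> topspace (subtopology ?P (Z n)). \<alpha> (x (Suc n)) = x n}" for n
  have proj: "continuous_map ?P X (\<lambda>x. x n)" for n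
    using continuous_map_product_coordinates[of n UNIV "\<lambda>_. X"] by simp
  have "closedin ?P (C n)" for n
  proof -
    have Z: "closedin ?P (Z n)"
      unfolding Z_def by (rule closedin_continuous_map_preimage[OF proj D1_closed])
    have "continuous_map (subtopology ?P (Z n)) (subtopology X D1) (\<lambda>x. x (Suc n))"
      using continuous_map_from_subtopology[OF proj]
      by (auto simp: continuous_map_in_subtopology Z_def)
    from continuous_map_compose[OF this continuous]
    have 1: "continuous_map (subtopology ?P (Z n)) X (\<lambda>x. \<alpha> (x (Suc n)))"
      by (simp add: o_def)
    have "closedin (subtopology ?P (Z n)) (C n)"
      unfolding C_def
      by (rule closedin_continuous_maps_eq[OF Hausdorff 1 continuous_map_from_subtopology[OF proj]])
    then show ?thesis by (rule closedin_trans_full[OF _ Z])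
  qed
  then have "closedin ?P (\<Inter>n. C n)" by (intro closedin_INT) auto
  moreover have "compact_space ?P" by (simp add: compact_space_product_topology compact)
  ultimately have "compactin ?P (\<Inter>n. C n)" by (simp add: closedin_compact_space)
  moreover have "continuous_map ?P (product_topology (\<lambda>_. adjoin_point X) UNIV) (\<lambda>x n. Some (x n))"
    unfolding continuous_map_componentwise_UNIV
    using continuous_map_compose[OF proj continuous_map_Some] by (simp add: o_def)
  ultimately have "compactin (product_topology (\<lambda>_. adjoin_point X) UNIV)
      ((\<lambda>x n. Some (x n)) ` (\<Inter>n. C n))"
    by (rule image_compactin)
  moreover have "(\<Inter>n. C n) = {x. thread x}"
    unfolding C_def Z_def thread_def by (auto simp: PiE_UNIV_domain Pi_iff)
  moreover have "(\<lambda>x n. Some (x n)) ` {x. thread x} = ext_inf X D1 \<alpha>"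
    unfolding ext_inf_eq by auto
  ultimately show ?thesis unfolding ext_space_eq by (simp add: compact_space_subtopology)
qed

lemma continuous_map_coord: "continuous_map Xt X (\<lambda>s. the (s n))"
proof -
  have "openin Xt {s \<in> topspace Xt. the (s n) \<in> V}" if V: "openin X V" for V
  proof -
    have "continuous_map Xt (adjoin_point X) (\<lambda>s. s n)"
      unfolding ext_space_eq
      by (intro continuous_map_from_subtopology continuous_map_product_coordinates) simp
    from openin_continuous_map_preimage[OF this openin_Some_image[OF V]]
    have "openin Xt {s \<in> topspace Xt. s n \<in> Some ` V}" .
    moreover have "{s \<in> topspace Xt. s n \<in> Some ` V} = {s \<in> topspace Xt. the (s n) \<in> V}"
      unfolding topspace_ext by auto
    ultimately show ?thesis by simp
  qed
  moreover have "the (s n) \<in> topspace X" if "s \<in> topspace Xt" for s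
    using that unfolding topspace_ext thread_def by auto
  ultimately show ?thesis by (simp add: continuous_map_def)
qed

lemma D1t_open: "openin Xt D1t" and D1t_closed: "closedin Xt D1t"
  unfolding ext_preimage_def ext_proj_def
  using openin_continuous_map_preimage[OF continuous_map_coord D1_open]
    closedin_continuous_map_preimage[OF continuous_map_coord D1_closed] by auto

lemma ext_preimage_topspace: "ext_preimage X D1 \<alpha> (topspace X) = topspace Xt"
  unfolding ext_preimage_def ext_proj_def
  using continuous_map_image_subset_topspace[OF continuous_map_coord[of 0]] by blast

section \<open>The shift on threads\<close>

lemma thread_shift:
  assumes "thread x" "x 0 \<in> D1"
  shows "thread (\<lambda>n. case n of 0 \<Rightarrow> \<alpha> (x 0) | Suc m \<Rightarrow> x m)"
  unfolding thread_def
proof (intro conjI allI)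
  fix n
  show "(case n of 0 \<Rightarrow> \<alpha> (x 0) | Suc m \<Rightarrow> x m) \<in> topspace X"
    using assms onto by (cases n) (auto simp: thread_def)
  show "(case Suc n of 0 \<Rightarrow> \<alpha> (x 0) | Suc m \<Rightarrow> x m) \<in> D1"
    using assms by (cases n) (auto simp: thread_def)
  show "\<alpha> (case Suc n of 0 \<Rightarrow> \<alpha> (x 0) | Suc m \<Rightarrow> x m) = (case n of 0 \<Rightarrow> \<alpha> (x 0) | Suc m \<Rightarrow> x m)"
    using assms by (cases n) (auto simp: thread_def)
qed

lemma D1tE:
  assumes "s \<in> D1t"
  obtains x where "thread x" "x 0 \<in> D1" "s = (\<lambda>n. Some (x n))"
  using assms unfolding ext_preimage_def ext_proj_def topspace_ext by auto

lemma ext_map_in_topspace: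
  assumes "s \<in> D1t" shows "ext_map \<alpha> s \<in> topspace Xt"
proof -
  obtain x where x: "thread x" "x 0 \<in> D1" "s = (\<lambda>n. Some (x n))" using assms by (rule D1tE)
  have "ext_map \<alpha> s = (\<lambda>n. Some (case n of 0 \<Rightarrow> \<alpha> (x 0) | Suc m \<Rightarrow> x m))"
    by (auto simp: x(3) ext_map_def ext_proj_def split: nat.split)
  then show ?thesis unfolding topspace_ext using thread_shift[OF x(1,2)] by blast
qed

lemma continuous_map_ext_map: "continuous_map (subtopology Xt D1t) Xt (ext_map \<alpha>)"
proof -
  have "continuous_map (subtopology Xt D1t) (adjoin_point X) (\<lambda>s. ext_map \<alpha> s n)" for n
  proof (cases n)
    case 0
    have "continuous_map (subtopology Xt D1t) (subtopology X D1) (\<lambda>s. the (s 0))"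
      using continuous_map_from_subtopology[OF continuous_map_coord]
      by (auto simp: continuous_map_in_subtopology ext_preimage_def ext_proj_def)
    from continuous_map_compose[OF continuous_map_compose[OF this continuous] continuous_map_Some]
    show ?thesis by (simp add: 0 o_def ext_map_def ext_proj_def)
  next
    case (Suc m)
    have "continuous_map Xt (adjoin_point X) (\<lambda>s. s m)"
      unfolding ext_space_eq
      by (intro continuous_map_from_subtopology continuous_map_product_coordinates) simp
    then show ?thesis by (simp add: Suc ext_map_def continuous_map_from_subtopology)
  qed
  then have "continuous_map (subtopology Xt D1t) (product_topology (\<lambda>_. adjoin_point X) UNIV)
      (ext_map \<alpha>)"
    unfolding continuous_map_componentwise_UNIV by blast
  moreover have "ext_map \<alpha> ` D1t \<subseteq> ext_inf X D1 \<alpha>"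
    using ext_map_in_topspace unfolding ext_space_eq topspace_subtopology by blast
  ultimately show ?thesis
    using openin_subset[OF D1t_open]
    by (subst (2) ext_space_eq) (auto simp: continuous_map_in_subtopology)
qed

text \<open>Entries beyond n are iterated preimages, available because \<alpha> is onto; entries
  below n are iterated images, available because x lies in the domain of the n-th iterate.\<close>

lemma thread_through:
  assumes "x \<in> iter_dom X D1 \<alpha> n"
  obtains z where "thread z" "z n = x"
proof -
  define \<sigma> where "\<sigma> = inv_into D1 \<alpha>"
  have \<sigma>: "\<sigma> y \<in> D1" "\<alpha> (\<sigma> y) = y" if "y \<in> topspace X" for y
    using that unfolding \<sigma>_def onto[symmetric] by (rule inv_into_into f_inv_into_f)+
  have top: "(\<sigma> ^^ k) x \<in> topspace X" for k
  proof (induction k)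
    case 0
    show ?case using assms iter_dom_subset[of n] by auto
  next
    case (Suc k)
    then show ?case using \<sigma>(1) D1_subset by auto
  qed
  have th: "thread (\<lambda>k. (\<sigma> ^^ k) x)"
    unfolding thread_def using top \<sigma> by simp
  \<comment> \<open>Prepending \<alpha> of the first entry moves the thread one place to the right;
    n such steps bring x to position n.\<close>
  have extend: "\<exists>z. thread z \<and> (\<forall>k. z (n + k) = t k)"
    if "thread t" "t 0 \<in> iter_dom X D1 \<alpha> n" for t
    using that
  proof (induction n arbitrary: t)
    case 0
    then show ?case by auto
  next
    case (Suc n)
    let ?t = "\<lambda>k. case k of 0 \<Rightarrow> \<alpha> (t 0) | Suc m \<Rightarrow> t m"
    have "thread ?t" "?t 0 \<in> iter_dom X D1 \<alpha> n"
      using Suc.prems by (auto intro: thread_shift)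
    from Suc.IH[OF this] obtain z where z: "thread z" "\<And>k. z (n + k) = ?t k" by blast
    have "z (Suc n + k) = t k" for k using z(2)[of "Suc k"] by simp
    with z(1) show ?case by blast
  qed
  from extend[OF th] assms obtain z where "thread z" "\<And>k. z (n + k) = (\<sigma> ^^ k) x"
    by auto
  from this(1) this(2)[of 0] show thesis by (intro that[of z]) simp_all
qed

section \<open>Functions of a single coordinate\<close>

definition coord_embed :: "nat \<Rightarrow> ('a \<Rightarrow> complex) \<Rightarrow> (nat \<Rightarrow> 'a option) \<Rightarrow> complex"
  where "coord_embed n a = (\<lambda>s. if s \<in> topspace Xt then a (the (s n)) else 0)"

lemma coord_embed_0: "ext_embed X D1 \<alpha> a = coord_embed 0 a"
  by (rule ext) (simp add: ext_embed_def coord_embed_def ext_proj_def)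

lemma coord_embed_cfunctions:
  assumes "a \<in> cfunctions X" shows "coord_embed n a \<in> cfunctions Xt"
proof -
  have "continuous_map Xt euclidean (a \<circ> (\<lambda>s. the (s n)))"
    using assms by (intro continuous_map_compose[OF continuous_map_coord]) (simp add: cfunctions_def)
  then show ?thesis unfolding coord_embed_def by (intro cfunctions_restrict_topspace) (simp add: o_def)
qed

lemma coord_embed_hom:
  shows "coord_embed n (\<lambda>x. a x + b x) = (\<lambda>s. coord_embed n a s + coord_embed n b s)"
    and "coord_embed n (\<lambda>x. a x - b x) = (\<lambda>s. coord_embed n a s - coord_embed n b s)"
    and "coord_embed n (\<lambda>x. a x * b x) = (\<lambda>s. coord_embed n a s * coord_embed n b s)"
    and "coord_embed n (\<lambda>x. c * a x) = (\<lambda>s. c * coord_embed n a s)"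
    and "coord_embed n (\<lambda>x. cnj (a x)) = (\<lambda>s. cnj (coord_embed n a s))"
  by (auto simp: coord_embed_def)

text \<open>On a thread, entry n is the image of entry n + 1, which lies in \<open>D1\<close>. Hence
  the algebras of functions of one coordinate increase with n, and \<open>endo\<close> realises the
  inclusion.\<close>

lemma coord_embed_endo: "coord_embed (Suc n) (endo D1 \<alpha> a) = coord_embed n a"
proof
  show "coord_embed (Suc n) (endo D1 \<alpha> a) s = coord_embed n a s" for s
    unfolding coord_embed_def endo_def topspace_ext thread_def by auto
qed

lemma coord_embed_one: "coord_embed n (indicator (topspace X)) = indicator (topspace Xt)"
proof
  show "coord_embed n (indicator (topspace X)) s = (indicator (topspace Xt) s :: complex)" for s
    using continuous_map_image_subset_topspace[OF continuous_map_coord[of n]]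
    by (auto simp: coord_embed_def indicator_def)
qed

lemma coord_embed_D1: "coord_embed 0 (indicator D1) = indicator D1t"
  by (auto simp: coord_embed_def indicator_def ext_preimage_def ext_proj_def)

text \<open>The shift moves coordinate n to n + 1, so the extended endomorphism lowers the index.
  The indicator stays because coordinate n is defined off \<open>D1t\<close> as well, where the left
  side is 0.\<close>

lemma endo_coord_embed:
  "endo D1t (ext_map \<alpha>) (coord_embed (Suc n) a) = (\<lambda>s. coord_embed n a s * indicator D1t s)"
proof
  fix s
  have "the (ext_map \<alpha> s (Suc n)) = the (s n)" by (simp add: ext_map_def)
  then show "endo D1t (ext_map \<alpha>) (coord_embed (Suc n) a) s = coord_embed n a s * indicator D1t s"
    using ext_map_in_topspace[of s] openin_subset[OF D1t_open]
    by (auto simp: endo_def coord_embed_def indicator_def)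
qed

lemma endo_coord_embed_0: "endo D1t (ext_map \<alpha>) (coord_embed 0 a) = coord_embed 0 (endo D1 \<alpha> a)"
proof
  fix s
  have "the (ext_map \<alpha> s 0) = \<alpha> (the (s 0))" by (simp add: ext_map_def ext_proj_def)
  moreover have "s \<in> D1t \<longleftrightarrow> s \<in> topspace Xt \<and> the (s 0) \<in> D1"
    by (simp add: ext_preimage_def ext_proj_def)
  ultimately show "endo D1t (ext_map \<alpha>) (coord_embed 0 a) s = coord_embed 0 (endo D1 \<alpha> a) s"
    using ext_map_in_topspace[of s] by (simp add: endo_def coord_embed_def)
qed

lemma endo_cfunctions: "a \<in> cfunctions X \<Longrightarrow> endo D1 \<alpha> a \<in> cfunctions X"
  by (rule endo_in_cfunctions[OF D1_open D1_closed continuous])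

lemma endo_ext_cfunctions: "b \<in> cfunctions Xt \<Longrightarrow> endo D1t (ext_map \<alpha>) b \<in> cfunctions Xt"
  by (rule endo_in_cfunctions[OF D1t_open D1t_closed continuous_map_ext_map])

section \<open>The union of the coordinate algebras and its density\<close>

definition coord_algebra :: "((nat \<Rightarrow> 'a option) \<Rightarrow> complex) set"
  where "coord_algebra = {coord_embed n a | n a. a \<in> cfunctions X}"

lemma coord_embed_lift:
  assumes "a \<in> cfunctions X" "n \<le> m"
  obtains b where "b \<in> cfunctions X" "coord_embed m b = coord_embed n a"
proof -
  have "\<exists>b\<in>cfunctions X. coord_embed (n + k) b = coord_embed n a" for k
  proof (induction k)
    case 0
    show ?case using assms(1) by auto
  next
    case (Suc k)
    then obtain b where "b \<in> cfunctions X" "coord_embed (n + k) b = coord_embed n a" by blast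
    then show ?case
      using coord_embed_endo[of "n + k" b] endo_cfunctions[of b] by (intro bexI[of _ "endo D1 \<alpha> b"]) auto
  qed
  from this[of "m - n"] show thesis using \<open>n \<le> m\<close> that by auto
qed

lemma coord_algebra_pairE:
  assumes "f \<in> coord_algebra" "g \<in> coord_algebra"
  obtains n a b where "a \<in> cfunctions X" "b \<in> cfunctions X" "f = coord_embed n a" "g = coord_embed n b"
proof -
  obtain n a m b where a: "a \<in> cfunctions X" "f = coord_embed n a"
    and b: "b \<in> cfunctions X" "g = coord_embed m b"
    using assms unfolding coord_algebra_def by blast
  obtain a' where a': "a' \<in> cfunctions X" "coord_embed (max n m) a' = f"
    using coord_embed_lift[OF a(1), of n "max n m"] a(2) by auto
  obtain b' where b': "b' \<in> cfunctions X" "coord_embed (max n m) b' = g"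
    using coord_embed_lift[OF b(1), of m "max n m"] b(2) by auto
  from that[OF a'(1) b'(1) a'(2)[symmetric] b'(2)[symmetric]] show thesis .
qed

lemma coord_algebraI: "a \<in> cfunctions X \<Longrightarrow> coord_embed n a \<in> coord_algebra"
  unfolding coord_algebra_def by blast

lemma coord_algebra_subset: "coord_algebra \<subseteq> cfunctions Xt"
  unfolding coord_algebra_def using coord_embed_cfunctions by blast

lemma coord_algebra_closed:
  shows "f \<in> coord_algebra \<Longrightarrow> g \<in> coord_algebra \<Longrightarrow> (\<lambda>x. f x + g x) \<in> coord_algebra"
    and "f \<in> coord_algebra \<Longrightarrow> g \<in> coord_algebra \<Longrightarrow> (\<lambda>x. f x * g x) \<in> coord_algebra"
    and "f \<in> coord_algebra \<Longrightarrow> (\<lambda>x. c * f x) \<in> coord_algebra"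
    and "f \<in> coord_algebra \<Longrightarrow> (\<lambda>x. cnj (f x)) \<in> coord_algebra"
proof -
  assume f: "f \<in> coord_algebra"
  obtain n a where a: "a \<in> cfunctions X" "f = coord_embed n a"
    using f unfolding coord_algebra_def by blast
  show "(\<lambda>x. c * f x) \<in> coord_algebra" "(\<lambda>x. cnj (f x)) \<in> coord_algebra"
    unfolding a(2) coord_embed_hom(4,5)[symmetric]
    using a(1) by (intro coord_algebraI cfunctions_cmult cfunctions_cnj; simp)+
  assume g: "g \<in> coord_algebra"
  obtain n a b where ab: "a \<in> cfunctions X" "b \<in> cfunctions X" "f = coord_embed n a" "g = coord_embed n b"
    using coord_algebra_pairE[OF f g] .
  show "(\<lambda>x. f x + g x) \<in> coord_algebra" "(\<lambda>x. f x * g x) \<in> coord_algebra"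
    unfolding ab(3,4) coord_embed_hom(1,3)[symmetric]
    using ab(1,2) by (intro coord_algebraI cfunctions_add cfunctions_mult; simp)+
qed

lemma cfunctions_separate:
  assumes "x \<in> topspace X" "y \<in> topspace X" "x \<noteq> y"
  obtains a where "a \<in> cfunctions X" "a x \<noteq> a y"
proof -
  have "completely_regular_space X"
    using compact Hausdorff
    by (intro normal_imp_completely_regular_space compact_Hausdorff_or_regular_imp_normal_space) auto
  moreover have "closedin X {y}" using assms(2) Hausdorff by (simp add: closedin_Hausdorff_sing_eq)
  ultimately obtain u :: "'a \<Rightarrow> real"
    where u: "continuous_map X (top_of_set {0..1}) u" "u x = 0" "u ` {y} \<subseteq> {1}"
    unfolding completely_regular_space_def using assms(1,3) by blast
  let ?a = "\<lambda>z. if z \<in> topspace X then complex_of_real (u z) else 0"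
  have "continuous_map X euclideanreal u" using u(1) by (simp add: continuous_map_in_subtopology)
  then have "continuous_map X euclidean (\<lambda>z. complex_of_real (u z))"
    by (simp add: continuous_map_atin tendsto_of_real)
  then have "?a \<in> cfunctions X" by (rule cfunctions_restrict_topspace)
  moreover have "?a x \<noteq> ?a y" using u(2,3) assms(1,2) by auto
  ultimately show thesis by (rule that)
qed

lemma coord_algebra_dense:
  assumes "f \<in> cfunctions Xt" "e > 0"
  shows "\<exists>g\<in>coord_algebra. \<forall>s. cmod (f s - g s) < e"
proof (rule Stone_Weierstrass_cfunctions[OF compact_ext coord_algebra_subset _ _ _ _ _ _ assms])
  show "indicator (topspace Xt) \<in> coord_algebra"
    using coord_algebraI[OF cfunctions_indicator[OF openin_topspace closedin_topspace], of 0]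
    by (simp add: coord_embed_one)
  fix s t assume st: "s \<in> topspace Xt" "t \<in> topspace Xt" "s \<noteq> t"
  then obtain x y where xy: "thread x" "thread y" "s = (\<lambda>n. Some (x n))" "t = (\<lambda>n. Some (y n))"
    unfolding topspace_ext by blast
  then obtain n where "x n \<noteq> y n" using st(3) by blast
  then obtain a where a: "a \<in> cfunctions X" "a (x n) \<noteq> a (y n)"
    using cfunctions_separate[of "x n" "y n"] xy(1,2) unfolding thread_def by blast
  have "coord_embed n a s = a (x n)" using st(1) by (simp add: coord_embed_def xy(3))
  moreover have "coord_embed n a t = a (y n)" using st(2) by (simp add: coord_embed_def xy(4))
  ultimately have "coord_embed n a s \<noteq> coord_embed n a t" using a(2) by simp
  then show "\<exists>f\<in>coord_algebra. f s \<noteq> f t"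
    by (intro bexI[of _ "coord_embed n a"] coord_algebraI[OF a(1)])
qed (fact coord_algebra_closed)+

end

section \<open>Covariant representations\<close>

lemma cfunctions_one: "indicator (topspace Y) \<in> cfunctions Y"
  by (rule cfunctions_indicator[OF openin_topspace closedin_topspace])

lemma indicator_mult_cfunctions:
  assumes "a \<in> cfunctions_on D Y"
  shows "(\<lambda>x. indicator D x * a x) = a" "(\<lambda>x. a x * indicator D x) = a"
  using assms by (auto simp: cfunctions_on_def indicator_def fun_eq_iff)

lemma cfunctions_on_topspace: "cfunctions_on (topspace Y) Y = cfunctions Y"
  by (auto simp: cfunctions_on_def cfunctions_def)

lemma indicator_in_cfunctions_on:
  assumes "openin Y D" "closedin Y D" shows "indicator D \<in> cfunctions_on D Y"
  using cfunctions_indicator[OF assms] by (simp add: cfunctions_on_def)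

text \<open>The indicator of \<open>D\<close> is a unit for the functions supported in
  \<open>D\<close>. The spaces prescribed for \<open>U\<close> thereby become ranges of single
  projections.\<close>

lemma representation_range_indicator:
  assumes \<pi>: "representation Y \<pi>" and D: "openin Y D" "closedin Y D"
  shows "{\<pi> a h | a h. a \<in> cfunctions_on D Y} = range (\<pi> (indicator D))"
proof
  show "range (\<pi> (indicator D)) \<subseteq> {\<pi> a h | a h. a \<in> cfunctions_on D Y}"
    using indicator_in_cfunctions_on[OF D] by blast
  have "\<pi> a h \<in> range (\<pi> (indicator D))" if a: "a \<in> cfunctions_on D Y" for a h
  proof -
    have "a \<in> cfunctions Y" using a by (simp add: cfunctions_on_def)
    from representation_mult[OF \<pi> cfunctions_indicator[OF D] this]
    have "\<pi> a = \<pi> (indicator D) \<circ> \<pi> a" by (simp only: indicator_mult_cfunctions(1)[OF a])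
    then have "\<pi> a h = \<pi> (indicator D) (\<pi> a h)" by (metis comp_apply)
    then show ?thesis by (rule range_eqI)
  qed
  then show "{\<pi> a h | a h. a \<in> cfunctions_on D Y} \<subseteq> range (\<pi> (indicator D))" by blast
qed

lemma representation_one:
  assumes \<pi>: "representation Y \<pi>" and a: "a \<in> cfunctions Y"
  shows "\<pi> (indicator (topspace Y)) \<circ> \<pi> a = \<pi> a" "\<pi> a \<circ> \<pi> (indicator (topspace Y)) = \<pi> a"
proof -
  have a': "a \<in> cfunctions_on (topspace Y) Y" using a by (simp add: cfunctions_on_topspace)
  show "\<pi> (indicator (topspace Y)) \<circ> \<pi> a = \<pi> a"
    using representation_mult[OF \<pi> cfunctions_one a]
    by (simp only: indicator_mult_cfunctions(1)[OF a'])
  show "\<pi> a \<circ> \<pi> (indicator (topspace Y)) = \<pi> a"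
    using representation_mult[OF \<pi> a cfunctions_one]
    by (simp only: indicator_mult_cfunctions(2)[OF a'])
qed

lemma CovRepD:
  assumes "(\<pi>, U) \<in> CovRep Y D Dm \<delta>"
  shows CovRep_representation: "representation Y \<pi>"
    and CovRep_partial_isometry: "partial_isometry U"
    and CovRep_initial: "initial_space U = {\<pi> a h | a h. a \<in> cfunctions_on Dm Y}"
    and CovRep_final: "final_space U = {\<pi> a h | a h. a \<in> cfunctions_on D Y}"
    and CovRep_covariant: "a \<in> cfunctions Y \<Longrightarrow> U \<circ> \<pi> a \<circ> cadjoint U = \<pi> (\<delta> a)"
  using assms unfolding CovRep_def by blast+

lemma CovRep_bounded: "(\<pi>, U) \<in> CovRep Y D Dm \<delta> \<Longrightarrow> U \<in> bounded_operators"
  using CovRep_partial_isometry unfolding partial_isometry_def by blast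

text \<open>The initial space of \<open>U\<close> is the range of the projection \<open>\<pi> 1\<close>, and \<open>U\<^sup>*\<close> maps into it.\<close>

lemma CovRep_adjoint_comp:
  assumes "(\<pi>, U) \<in> CovRep Y D (topspace Y) \<delta>"
  shows "cadjoint U \<circ> U = \<pi> (indicator (topspace Y))"
    and "U \<circ> \<pi> (indicator (topspace Y)) = U"
proof -
  note \<pi> = CovRep_representation[OF assms] and Ub = CovRep_bounded[OF assms]
  define P where "P = \<pi> (indicator (topspace Y))"
  have Pb: "P \<in> bounded_operators"
    unfolding P_def by (rule representation_bounded[OF \<pi> cfunctions_one])
  have PP: "P (P x) = P x" for x
    using fun_cong[OF representation_one(1)[OF \<pi> cfunctions_one], of x] by (simp add: P_def)
  have "cadjoint P = \<pi> (\<lambda>x. cnj (indicator (topspace Y) x))"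
    unfolding P_def by (rule representation_cnj[OF \<pi> cfunctions_one, symmetric])
  also have "(\<lambda>x. cnj (indicator (topspace Y) x)) = (indicator (topspace Y) :: _ \<Rightarrow> complex)"
    by (auto simp: indicator_def)
  finally have P_self: "cadjoint P = P" by (simp add: P_def)
  have init: "initial_space U = range P"
    unfolding CovRep_initial[OF assms] P_def
    by (rule representation_range_indicator[OF \<pi> openin_topspace closedin_topspace])
  have adj_init: "cadjoint U y \<in> range P" for y
    unfolding init[symmetric] initial_space_def
    by (simp add: cinner_cadjoint_left[OF Ub] cinner_zero_right)
  have UP: "U (P x) = U x" for x
  proof -
    \<comment> \<open>\<open>d\<close> is in the kernel of the projection \<open>P\<close>, hence
      orthogonal to its range, where the adjoint of \<open>U\<close> takes its values; so |U d|^2 =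
      0.\<close>
    define d where "d = x - P x"
    obtain w where w: "cadjoint U (U d) = P w" using adj_init by blast
    have "P d = 0" by (simp add: d_def bounded_operatorsD(4)[OF Pb] PP)
    have "cinner (U d) (U d) = cinner d (P w)" by (simp add: cinner_cadjoint_right[OF Ub] w)
    also have "\<dots> = cinner (P d) w" by (simp add: cinner_cadjoint_right[OF Pb] P_self)
    also have "\<dots> = 0" using \<open>P d = 0\<close> cinner_diff_left[of d d w] by simp
    finally have "U d = 0" by (simp add: cinner_self)
    then show ?thesis by (simp add: d_def bounded_operatorsD(4)[OF Ub])
  qed
  then show "U \<circ> \<pi> (indicator (topspace Y)) = U" by (auto simp: P_def)
  have nrm: "norm (U (P x)) = norm (P x)" for x
    using CovRep_partial_isometry[OF assms] unfolding partial_isometry_def init by blast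
  \<comment> \<open>Polarisation: preservation of norms on the range of \<open>P\<close> gives
    preservation of the real inner product, and then of the complex one.\<close>
  have inn: "inner (U (P x)) (U (P y)) = inner (P x) (P y)" for x y
  proof -
    have "norm (U (P x) + U (P y)) = norm (P x + P y)"
      using nrm[of "x + y"] by (simp add: bounded_operatorsD(3)[OF Pb] bounded_operatorsD(3)[OF Ub])
    then show ?thesis by (simp add: dot_norm nrm)
  qed
  have cinn: "cinner (U (P x)) (U (P y)) = cinner (P x) (P y)" for x y
    using inn[of x y] inn[of x "\<i> *\<^sub>C y"]
    by (simp add: cinner_eq_Complex bounded_operatorsD(2)[OF Pb] bounded_operatorsD(2)[OF Ub])
  show "cadjoint U \<circ> U = \<pi> (indicator (topspace Y))"
  proof
    fix x
    have "cinner (cadjoint U (U x)) y = cinner (P x) y" for y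
    proof -
      have "cinner (cadjoint U (U x)) y = cinner (U (P x)) (U (P y))"
        by (simp add: cinner_cadjoint_left[OF Ub] UP)
      also have "\<dots> = cinner (P (P x)) y"
        unfolding cinn by (simp add: cinner_cadjoint_right[OF Pb, of "P x"] P_self)
      finally show ?thesis by (simp add: PP)
    qed
    then have "cadjoint U (U x) = P x" by (rule cinner_eq_leftI)
    then show "(cadjoint U \<circ> U) x = \<pi> (indicator (topspace Y)) x" by (simp add: P_def)
  qed
qed

text \<open>Covariance at the unit, which \<open>endo\<close> maps to the indicator of
  \<open>D\<close>; \<open>U\<close> absorbs the projection \<pi>(1) standing in the middle.\<close>

lemma CovRep_comp_adjoint:
  assumes rep: "(\<pi>, U) \<in> CovRep Y D (topspace Y) (endo D f)"
    and D: "D \<subseteq> topspace Y" "f ` D \<subseteq> topspace Y"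
  shows "U \<circ> cadjoint U = \<pi> (indicator D)"
proof -
  have "endo D f (indicator (topspace Y)) = indicator D"
    using D by (auto simp: endo_def indicator_def fun_eq_iff)
  then have "\<pi> (indicator D) = U \<circ> \<pi> (indicator (topspace Y)) \<circ> cadjoint U"
    using CovRep_covariant[OF rep cfunctions_one] by simp
  also have "\<dots> = U \<circ> cadjoint U" by (simp only: CovRep_adjoint_comp(2)[OF rep])
  finally show ?thesis by simp
qed

lemma representation_indicator_norm:
  assumes "representation Y \<pi>" "openin Y D" "closedin Y D"
  shows "norm (\<pi> (indicator D) h) \<le> norm h"
proof -
  have "norm (\<pi> (indicator D) h) \<le> 1 * norm h"
    using assms(1) cfunctions_indicator[OF assms(2,3)]
    by (rule representation_contractive) (simp add: indicator_def)
  then show ?thesis by simp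
qed

text \<open>An inequality form of the C*-identity, to be used for \<open>U\<close> and for its
  adjoint, where the composite is the image of an indicator.\<close>

lemma norm_le_if_adjoint_comp:
  assumes V: "V \<in> bounded_operators" and le: "\<And>h. norm (cadjoint V (V h)) \<le> norm h"
  shows "norm (V h) \<le> norm h"
proof -
  have "(norm (V h))\<^sup>2 = inner (cadjoint V (V h)) h"
    using cinner_cadjoint_left[OF V, of "V h" h] cinner_self[of "V h"]
    by (metis Re_complex_of_real inner_eq_Re_cinner)
  also have "\<dots> \<le> norm (cadjoint V (V h)) * norm h" by (rule norm_cauchy_schwarz)
  also have "\<dots> \<le> norm h * norm h" by (intro mult_right_mono le) simp
  finally have "(norm (V h))\<^sup>2 \<le> (norm h)\<^sup>2" by (simp add: power2_eq_square)
  then show ?thesis by (rule power2_le_imp_le) simp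
qed

section \<open>Extension of a covariant pair to the coefficient algebra\<close>

locale covariant_pair = onto_partial_map X D1 \<alpha>
  for X :: "'a topology" and D1 \<alpha> +
  fixes \<pi> :: "('a \<Rightarrow> complex) \<Rightarrow> 'h::complex_hilbert_space \<Rightarrow> 'h" and U :: "'h \<Rightarrow> 'h"
  assumes CovRep: "(\<pi>, U) \<in> CovRep X D1 (topspace X) (endo D1 \<alpha>)"
begin

lemmas rep = CovRep_representation[OF CovRep]
  and U_bounded = CovRep_bounded[OF CovRep]

lemmas Ustar_bounded = cadjoint_bounded_operators[OF U_bounded]

lemma Ustar_U: "cadjoint U (U h) = \<pi> (indicator (topspace X)) h"
  using fun_cong[OF CovRep_adjoint_comp(1)[OF CovRep], of h] by simp

lemma U_Ustar: "U (cadjoint U h) = \<pi> (indicator D1) h"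
  using fun_cong[OF CovRep_comp_adjoint[OF CovRep D1_subset], of h] onto by simp

text \<open>The partial isometry identity
  \<open>cadjoint U \<circ> U \<circ> cadjoint U = cadjoint U\<close>. It is what lets the cut-off
  to \<open>D1\<close> be inserted or removed behind the adjoint.\<close>

lemma Ustar_indicator: "cadjoint U (\<pi> (indicator D1) h) = cadjoint U h"
proof (rule cinner_eq_leftI)
  fix y
  have UP: "U (\<pi> (indicator (topspace X)) y) = U y"
    using fun_cong[OF CovRep_adjoint_comp(2)[OF CovRep], of y] by simp
  have "cinner (cadjoint U (\<pi> (indicator D1) h)) y = cinner (U (cadjoint U h)) (U y)"
    by (simp only: cinner_cadjoint_left[OF U_bounded] U_Ustar)
  also have "\<dots> = cinner h (U (cadjoint U (U y)))"
    by (simp only: cinner_cadjoint_right[OF U_bounded, of _ "U y"] cinner_cadjoint_left[OF U_bounded])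
  also have "\<dots> = cinner (cadjoint U h) y"
    by (simp only: Ustar_U UP cinner_cadjoint_left[OF U_bounded])
  finally show "cinner (cadjoint U (\<pi> (indicator D1) h)) y = cinner (cadjoint U h) y" .
qed

lemma U_norm: "norm (U h) \<le> norm h"
  by (rule norm_le_if_adjoint_comp[OF U_bounded])
    (simp add: Ustar_U representation_indicator_norm[OF rep openin_topspace closedin_topspace])

lemma Ustar_norm: "norm (cadjoint U h) \<le> norm h"
  by (rule norm_le_if_adjoint_comp[OF Ustar_bounded])
    (simp add: cadjoint_cadjoint[OF U_bounded] U_Ustar
      representation_indicator_norm[OF rep D1_open D1_closed])

text \<open>The argument is a function on all of \<open>X\<close>, although coordinate n sees it
  only on \<open>iter_dom n\<close>; that its other values do not matter is the content of
  \<open>iter_rep_contractive\<close>.\<close>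

primrec iter_rep :: "nat \<Rightarrow> ('a \<Rightarrow> complex) \<Rightarrow> 'h \<Rightarrow> 'h"
  where
    "iter_rep 0 a = \<pi> a"
  | "iter_rep (Suc n) a = cadjoint U \<circ> iter_rep n a \<circ> U"

lemma iter_rep_bounded: "a \<in> cfunctions X \<Longrightarrow> iter_rep n a \<in> bounded_operators"
  by (induction n)
    (simp_all add: representation_bounded[OF rep] bounded_operators_comp U_bounded Ustar_bounded)

lemma iter_rep_add:
  assumes "a \<in> cfunctions X" "b \<in> cfunctions X"
  shows "iter_rep n (\<lambda>x. a x + b x) h = iter_rep n a h + iter_rep n b h"
  by (induction n arbitrary: h)
    (simp_all add: representation_add[OF rep assms] bounded_operatorsD(3)[OF Ustar_bounded])

lemma iter_rep_cmult:
  assumes "a \<in> cfunctions X"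
  shows "iter_rep n (\<lambda>x. c * a x) h = c *\<^sub>C iter_rep n a h"
  by (induction n arbitrary: h)
    (simp_all add: representation_cmult[OF rep assms] bounded_operatorsD(2)[OF Ustar_bounded])

lemma iter_rep_diff:
  assumes "a \<in> cfunctions X" "b \<in> cfunctions X"
  shows "iter_rep n (\<lambda>x. a x - b x) h = iter_rep n a h - iter_rep n b h"
  by (induction n arbitrary: h)
    (simp_all add: representation_diff[OF rep assms] bounded_operatorsD(4)[OF Ustar_bounded])

lemma iter_rep_cnj:
  assumes "a \<in> cfunctions X"
  shows "iter_rep n (\<lambda>x. cnj (a x)) = cadjoint (iter_rep n a)"
proof (induction n)
  case 0
  show ?case by (simp add: representation_cnj[OF rep assms])
next
  case (Suc n)
  then show ?case
    by (simp only: iter_rep.simps comp_assoc cadjoint_cadjoint[OF U_bounded]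
        cadjoint_comp[OF Ustar_bounded bounded_operators_comp[OF iter_rep_bounded[OF assms] U_bounded]]
        cadjoint_comp[OF iter_rep_bounded[OF assms] U_bounded])
qed

text \<open>At level 0, covariance turns the left side into \<pi>(1) \<pi>(a) \<pi>(1); higher
  levels wrap both sides in the same way. It is the operator counterpart of
  \<open>coord_embed_endo\<close>.\<close>

lemma iter_rep_endo:
  assumes a: "a \<in> cfunctions X"
  shows "iter_rep (Suc n) (endo D1 \<alpha> a) = iter_rep n a"
proof (induction n)
  case 0
  show ?case
  proof
    fix h
    let ?P = "\<pi> (indicator (topspace X))"
    have "iter_rep (Suc 0) (endo D1 \<alpha> a) h = cadjoint U (U (\<pi> a (cadjoint U (U h))))"
      by (simp only: iter_rep.simps o_apply CovRep_covariant[OF CovRep a, symmetric])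
    also have "\<dots> = ?P (\<pi> a (?P h))" by (simp only: Ustar_U)
    also have "\<dots> = \<pi> a h"
      using fun_cong[OF representation_one(1)[OF rep a], of "?P h"]
        fun_cong[OF representation_one(2)[OF rep a], of h] by simp
    finally show "iter_rep (Suc 0) (endo D1 \<alpha> a) h = iter_rep 0 a h" by simp
  qed
next
  case (Suc n)
  show ?case
    by (simp only: iter_rep.simps(2)[of "Suc n"] iter_rep.simps(2)[of n a] Suc.IH)
qed

text \<open>The indicator of \<open>iter_dom (Suc n)\<close>, one index above n. Writing it as an
  iterate of \<open>endo\<close> makes \<open>iter_rep_endo\<close> and
  \<open>coord_embed_endo\<close> applicable to it.\<close>

definition dom_ind :: "nat \<Rightarrow> 'a \<Rightarrow> complex"
  where "dom_ind n = (endo D1 \<alpha> ^^ n) (indicator D1)"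

lemma dom_ind_eq: "dom_ind n x = indicator (iter_dom X D1 \<alpha> (Suc n)) x"
proof (induction n arbitrary: x)
  case 0
  have "\<alpha> x \<in> topspace X" if "x \<in> D1" using that onto by blast
  then show ?case by (auto simp: dom_ind_def indicator_def)
next
  case (Suc n)
  have "dom_ind (Suc n) x = (if x \<in> D1 then dom_ind n (\<alpha> x) else 0)"
    by (simp add: dom_ind_def endo_def)
  then show ?case unfolding Suc.IH by (auto simp: indicator_def)
qed

lemma dom_ind_cfunctions: "dom_ind n \<in> cfunctions X"
  unfolding dom_ind_def
  by (induction n) (simp_all add: cfunctions_indicator[OF D1_open D1_closed] endo_cfunctions)

text \<open>The projection \<open>U \<circ> cadjoint U\<close> is thereby a value of every level,
  and can be multiplied into the functions of that level.\<close>

lemma iter_rep_dom_ind: "iter_rep n (dom_ind n) = \<pi> (indicator D1)"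
proof (induction n)
  case 0
  show ?case by (simp add: dom_ind_def)
next
  case (Suc n)
  have "dom_ind (Suc n) = endo D1 \<alpha> (dom_ind n)" by (simp add: dom_ind_def)
  then show ?case using iter_rep_endo[OF dom_ind_cfunctions] Suc by simp
qed

lemma coord_embed_dom_ind: "coord_embed n (dom_ind n) = indicator D1t"
proof (induction n)
  case 0
  show ?case by (simp add: dom_ind_def coord_embed_D1)
next
  case (Suc n)
  have "dom_ind (Suc n) = endo D1 \<alpha> (dom_ind n)" by (simp add: dom_ind_def)
  then show ?case using coord_embed_endo[of n "dom_ind n"] Suc by simp
qed

text \<open>At level n + 1 the two factors are separated by \<open>U \<circ> cadjoint U\<close>,
  which is the value of level n at \<open>dom_ind n\<close>. Commutativity moves this function to
  the front, where the outer adjoint absorbs it.\<close>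

lemma iter_rep_mult:
  assumes "a \<in> cfunctions X" "b \<in> cfunctions X"
  shows "iter_rep n (\<lambda>x. a x * b x) h = iter_rep n a (iter_rep n b h)"
  using assms
proof (induction n arbitrary: a b h)
  case 0
  then show ?case using fun_cong[OF representation_mult[OF rep 0(1,2)], of h] by simp
next
  case (Suc n)
  let ?d = "dom_ind n" and ?T = "iter_rep n"
  note d = dom_ind_cfunctions[of n]
  have "iter_rep (Suc n) a (iter_rep (Suc n) b h) = cadjoint U (?T a (?T ?d (?T b (U h))))"
    by (simp add: U_Ustar iter_rep_dom_ind)
  also have "?T a (?T ?d (?T b (U h))) = ?T (\<lambda>x. a x * (?d x * b x)) (U h)"
    by (simp only: Suc.IH[OF Suc.prems(1) cfunctions_mult[OF d Suc.prems(2)]]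
        Suc.IH[OF d Suc.prems(2)])
  also have "(\<lambda>x. a x * (?d x * b x)) = (\<lambda>x. ?d x * (a x * b x))" by (auto simp: mult_ac)
  also have "?T \<dots> (U h) = \<pi> (indicator D1) (?T (\<lambda>x. a x * b x) (U h))"
    by (simp only: Suc.IH[OF d cfunctions_mult[OF Suc.prems]] iter_rep_dom_ind)
  finally show ?case by (simp add: Ustar_indicator)
qed

text \<open>Because the outer adjoint absorbs the value at \<open>dom_ind n\<close>, the function
  may be cut down to \<open>iter_dom (Suc n)\<close> before the induction hypothesis is applied at
  level n.\<close>

lemma iter_rep_contractive:
  assumes "a \<in> cfunctions X" "C \<ge> 0" "\<And>x. x \<in> iter_dom X D1 \<alpha> n \<Longrightarrow> cmod (a x) \<le> C"
  shows "norm (iter_rep n a h) \<le> C * norm h"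
  using assms
proof (induction n arbitrary: a h)
  case 0
  have "cmod (a x) \<le> C" for x
  proof (cases "x \<in> topspace X")
    case True
    then show ?thesis using 0(3)[of x] by simp
  next
    case False
    then show ?thesis using 0(1,2) by (simp add: cfunctions_def)
  qed
  from representation_contractive[OF rep 0(1) this] show ?case by simp
next
  case (Suc n)
  have "iter_rep (Suc n) a h = cadjoint U (iter_rep n (\<lambda>x. dom_ind n x * a x) (U h))"
    by (simp add: iter_rep_mult[OF dom_ind_cfunctions Suc.prems(1)] iter_rep_dom_ind Ustar_indicator)
  then have "norm (iter_rep (Suc n) a h) \<le> norm (iter_rep n (\<lambda>x. dom_ind n x * a x) (U h))"
    by (simp only: Ustar_norm)
  also have "\<dots> \<le> C * norm (U h)"
  proof (rule Suc.IH[OF cfunctions_mult[OF dom_ind_cfunctions Suc.prems(1)] Suc.prems(2)])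
    show "cmod (dom_ind n x * a x) \<le> C" for x
      using Suc.prems(2) Suc.prems(3)[of x]
      by (cases "x \<in> iter_dom X D1 \<alpha> (Suc n)") (simp_all only: dom_ind_eq indicator_simps, simp_all)
  qed
  also have "\<dots> \<le> C * norm h" using Suc.prems(2) U_norm by (rule mult_left_mono[rotated])
  finally show ?case .
qed

text \<open>By \<open>thread_through\<close>, every value of \<open>a\<close> on
  \<open>iter_dom n\<close> is a value of the function of coordinate n on the extended
  space.\<close>

lemma iter_rep_contractive_coord:
  assumes "a \<in> cfunctions X" "\<And>s. cmod (coord_embed n a s) \<le> C"
  shows "norm (iter_rep n a h) \<le> C * norm h"
proof (rule iter_rep_contractive[OF assms(1)])
  show "C \<ge> 0" by (rule order_trans[OF norm_ge_zero assms(2)])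
  fix x assume "x \<in> iter_dom X D1 \<alpha> n"
  then obtain z where z: "thread z" "z n = x" by (rule thread_through)
  have "coord_embed n a (\<lambda>n. Some (z n)) = a x"
    using z unfolding coord_embed_def topspace_ext by auto
  with assms(2)[of "\<lambda>n. Some (z n)"] show "cmod (a x) \<le> C" by simp
qed

lemma iter_rep_lift:
  assumes "a \<in> cfunctions X" "n \<le> m"
  obtains b where "b \<in> cfunctions X" "coord_embed m b = coord_embed n a" "iter_rep m b = iter_rep n a"
proof -
  have "\<exists>b\<in>cfunctions X. coord_embed (n + k) b = coord_embed n a \<and> iter_rep (n + k) b = iter_rep n a" for k
  proof (induction k)
    case 0
    show ?case using assms(1) by auto
  next
    case (Suc k)
    then obtain b where b: "b \<in> cfunctions X" "coord_embed (n + k) b = coord_embed n a"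
      "iter_rep (n + k) b = iter_rep n a" by blast
    show ?case
      using coord_embed_endo[of "n + k" b] iter_rep_endo[OF b(1), of "n + k"] b(2,3)
      by (intro bexI[OF _ endo_cfunctions[OF b(1)]]) (simp del: iter_rep.simps)
  qed
  from this[of "m - n"] show thesis using \<open>n \<le> m\<close> that by auto
qed

lemma iter_rep_well_defined:
  assumes a: "a \<in> cfunctions X" and b: "b \<in> cfunctions X"
    and eq: "coord_embed n a = coord_embed m b"
  shows "iter_rep n a = iter_rep m b"
proof -
  obtain a' where a': "a' \<in> cfunctions X" "coord_embed (max n m) a' = coord_embed n a"
    "iter_rep (max n m) a' = iter_rep n a"
    using iter_rep_lift[OF a, of n "max n m"] by auto
  obtain b' where b': "b' \<in> cfunctions X" "coord_embed (max n m) b' = coord_embed m b"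
    "iter_rep (max n m) b' = iter_rep m b"
    using iter_rep_lift[OF b, of m "max n m"] by auto
  have "iter_rep (max n m) a' h = iter_rep (max n m) b' h" for h
  proof -
    \<comment> \<open>At the common level the difference is the zero function of that coordinate, so
      contractivity applies with constant 0.\<close>
    have "norm (iter_rep (max n m) (\<lambda>x. a' x - b' x) h) \<le> 0 * norm h"
      using a'(2) b'(2) eq
      by (intro iter_rep_contractive_coord cfunctions_diff a' b') (simp add: coord_embed_hom)
    then show ?thesis by (simp add: iter_rep_diff[OF a'(1) b'(1)])
  qed
  then show ?thesis using a'(3) b'(3) by auto
qed

lemma extension_representation:
  obtains \<rho> where "representation Xt \<rho>"
    "\<And>n a. a \<in> cfunctions X \<Longrightarrow> \<rho> (coord_embed n a) = iter_rep n a"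
proof -
  \<comment> \<open>A function has many presentations by an index and a function on
    \<open>X\<close>; \<open>iter_rep_well_defined\<close> makes the description unique.\<close>
  define r where "r f = (THE T. \<exists>n a. a \<in> cfunctions X \<and> f = coord_embed n a \<and> T = iter_rep n a)" for f
  have r: "r (coord_embed n a) = iter_rep n a" if "a \<in> cfunctions X" for n a
    unfolding r_def
  proof (rule the_equality)
    show "\<exists>n' a'. a' \<in> cfunctions X \<and> coord_embed n a = coord_embed n' a' \<and> iter_rep n a = iter_rep n' a'"
      using that by blast
    show "T = iter_rep n a"
      if "\<exists>n' a'. a' \<in> cfunctions X \<and> coord_embed n a = coord_embed n' a' \<and> T = iter_rep n' a'" for T
      using that iter_rep_well_defined[OF \<open>a \<in> cfunctions X\<close>] by metis
  qed
  obtain \<rho> where "representation Xt \<rho>" and \<rho>: "\<And>f. f \<in> coord_algebra \<Longrightarrow> \<rho> f = r f"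
  proof (rule representation_dense_extension[OF compact_ext coord_algebra_subset, of r])
    fix f g assume "f \<in> coord_algebra" "g \<in> coord_algebra"
    then obtain n a b where ab: "a \<in> cfunctions X" "b \<in> cfunctions X"
      "f = coord_embed n a" "g = coord_embed n b"
      by (rule coord_algebra_pairE)
    show "r (\<lambda>x. f x + g x) = (\<lambda>h. r f h + r g h)"
      unfolding ab(3,4) coord_embed_hom(1)[symmetric]
      by (simp add: r ab(1,2) cfunctions_add iter_rep_add[OF ab(1,2)] fun_eq_iff)
    show "r (\<lambda>x. f x * g x) = r f \<circ> r g"
      unfolding ab(3,4) coord_embed_hom(3)[symmetric]
      by (simp add: r ab(1,2) cfunctions_mult iter_rep_mult[OF ab(1,2)] fun_eq_iff)
  next
    fix f assume "f \<in> coord_algebra"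
    then obtain n a where a: "a \<in> cfunctions X" "f = coord_embed n a"
      unfolding coord_algebra_def by blast
    show "r (\<lambda>x. c * f x) = (\<lambda>h. c *\<^sub>C r f h)" for c
      unfolding a(2) coord_embed_hom(4)[symmetric]
      by (simp add: r a(1) cfunctions_cmult iter_rep_cmult[OF a(1)] fun_eq_iff)
    show "r (\<lambda>x. cnj (f x)) = cadjoint (r f)"
      unfolding a(2) coord_embed_hom(5)[symmetric]
      by (simp add: r a(1) cfunctions_cnj iter_rep_cnj[OF a(1)])
    show "r f \<in> bounded_operators" by (simp add: a(2) r a(1) iter_rep_bounded)
    show "norm (r f h) \<le> C * norm h" if "\<And>x. cmod (f x) \<le> C" for C h
      using iter_rep_contractive_coord[OF a(1), of n C h] that by (simp add: a(2) r a(1))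
  qed ((rule coord_algebra_closed coord_algebra_dense; assumption) | blast)+
  with r coord_algebraI show thesis by (intro that[of \<rho>]) simp_all
qed

text \<open>On each side of \<open>iter_rep n a\<close> stands \<open>U \<circ> cadjoint U\<close>,
  the value at \<open>dom_ind n\<close>. The two cut-offs merge into one because
  \<open>dom_ind n\<close> takes only the values 0 and 1.\<close>

lemma U_iter_rep_Ustar:
  assumes a: "a \<in> cfunctions X"
  shows "U \<circ> iter_rep (Suc n) a \<circ> cadjoint U = iter_rep n (\<lambda>x. a x * dom_ind n x)"
proof
  fix h
  have "(\<lambda>x. dom_ind n x * (a x * dom_ind n x)) = (\<lambda>x. a x * dom_ind n x)"
    by (auto simp: dom_ind_eq indicator_def)
  then have "iter_rep n (dom_ind n) (iter_rep n (\<lambda>x. a x * dom_ind n x) h)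
      = iter_rep n (\<lambda>x. a x * dom_ind n x) h"
    by (simp only: iter_rep_mult[OF dom_ind_cfunctions cfunctions_mult[OF a dom_ind_cfunctions], symmetric])
  moreover have "(U \<circ> iter_rep (Suc n) a \<circ> cadjoint U) h =
      iter_rep n (dom_ind n) (iter_rep n a (iter_rep n (dom_ind n) h))"
    by (simp add: U_Ustar iter_rep_dom_ind)
  ultimately show "(U \<circ> iter_rep (Suc n) a \<circ> cadjoint U) h = iter_rep n (\<lambda>x. a x * dom_ind n x) h"
    by (simp only: iter_rep_mult[OF a dom_ind_cfunctions])
qed

text \<open>Both sides, applied to a fixed vector, are continuous in \<open>b\<close> for uniform
  convergence, so functions of one coordinate suffice.\<close>

lemma extension_covariant:
  assumes \<rho>: "representation Xt \<rho>"
    and eq: "\<And>n a. a \<in> cfunctions X \<Longrightarrow> \<rho> (coord_embed n a) = iter_rep n a"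
    and b: "b \<in> cfunctions Xt"
  shows "U \<circ> \<rho> b \<circ> cadjoint U = \<rho> (endo D1t (ext_map \<alpha>) b)"
proof (rule ext)
  fix h
  let ?\<delta> = "endo D1t (ext_map \<alpha>)"
  have dense_eq: "U (\<rho> f (cadjoint U h)) = \<rho> (?\<delta> f) h" if f: "f \<in> coord_algebra" for f
  proof -
    obtain n a' where a': "a' \<in> cfunctions X" "f = coord_embed n a'"
      using f unfolding coord_algebra_def by blast
    \<comment> \<open>Raising the index to n + 1 puts even a function of coordinate 0 into the form
      to which \<open>endo_coord_embed\<close> applies.\<close>
    obtain a where "a \<in> cfunctions X" "coord_embed (Suc n) a = coord_embed n a'"
      by (rule coord_embed_lift[OF a'(1), of n "Suc n"]) simp
    with a'(2) have a: "a \<in> cfunctions X" "f = coord_embed (Suc n) a" by simp_all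
    have \<delta>f: "?\<delta> f = coord_embed n (\<lambda>x. a x * dom_ind n x)"
      by (simp only: a(2) endo_coord_embed coord_embed_hom(3) coord_embed_dom_ind)
    have "U (iter_rep (Suc n) a (cadjoint U h)) = iter_rep n (\<lambda>x. a x * dom_ind n x) h"
      using fun_cong[OF U_iter_rep_Ustar[OF a(1), of n], of h] by (simp only: o_apply)
    then show ?thesis
      unfolding \<delta>f eq[OF cfunctions_mult[OF a(1) dom_ind_cfunctions]]
      unfolding a(2) eq[OF a(1)] .
  qed
  obtain s where s: "\<And>k. s k \<in> coord_algebra" "uniform_limit UNIV s b sequentially"
    using uniform_approximation[OF coord_algebra_dense[OF b]] by metis
  have sc: "s k \<in> cfunctions Xt" for k using s(1) coord_algebra_subset by blast
  have "uniform_limit UNIV (\<lambda>k. ?\<delta> (s k)) (?\<delta> b) sequentially"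
  proof (rule uniform_limitI)
    fix e :: real assume "e > 0"
    from uniform_limitD[OF s(2) this]
    show "\<forall>\<^sub>F k in sequentially. \<forall>x\<in>UNIV. dist (?\<delta> (s k) x) (?\<delta> b x) < e"
      by eventually_elim (use \<open>e > 0\<close> in \<open>simp add: endo_def\<close>)
  qed
  then have "(\<lambda>k. \<rho> (?\<delta> (s k)) h) \<longlonglongrightarrow> \<rho> (?\<delta> b) h"
    by (rule representation_tendsto[OF \<rho> endo_ext_cfunctions[OF sc] endo_ext_cfunctions[OF b]])
  moreover have "(\<lambda>k. U (\<rho> (s k) (cadjoint U h))) \<longlonglongrightarrow> U (\<rho> b (cadjoint U h))"
    by (rule bounded_linear.tendsto[OF bounded_operatorsD(1)[OF U_bounded]
          representation_tendsto[OF \<rho> sc b s(2)]])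
  ultimately show "(U \<circ> \<rho> b \<circ> cadjoint U) h = \<rho> (?\<delta> b) h"
    unfolding dense_eq[OF s(1)] o_apply by (rule LIMSEQ_unique[rotated])
qed

end

section \<open>Restriction to C(X) and the bijection\<close>

context onto_partial_map
begin

abbreviation "\<delta>t \<equiv> endo D1t (ext_map \<alpha>)"

lemma restrict_rep_apply:
  "a \<in> cfunctions X \<Longrightarrow> restrict_rep X D1 \<alpha> \<rho> a = \<rho> (coord_embed 0 a)"
  by (simp add: restrict_rep_def coord_embed_0)

lemma restrict_representation:
  assumes \<rho>: "representation Xt \<rho>"
  shows "representation X (restrict_rep X D1 \<alpha> \<rho>)"
  unfolding representation_def
proof (intro conjI ballI allI)
  show "restrict_rep X D1 \<alpha> \<rho> \<in> cfunctions X \<rightarrow>\<^sub>E bounded_operators"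
    by (rule PiE_I)
      (simp_all add: restrict_rep_apply representation_bounded[OF \<rho>] coord_embed_cfunctions,
        simp add: restrict_rep_def)
  fix a assume a: "a \<in> cfunctions X"
  show "restrict_rep X D1 \<alpha> \<rho> (\<lambda>x. c * a x) = (\<lambda>h. c *\<^sub>C restrict_rep X D1 \<alpha> \<rho> a h)" for c
    by (simp only: restrict_rep_apply a cfunctions_cmult coord_embed_hom(4)
        representation_cmult[OF \<rho> coord_embed_cfunctions])
  show "restrict_rep X D1 \<alpha> \<rho> (\<lambda>x. cnj (a x)) = cadjoint (restrict_rep X D1 \<alpha> \<rho> a)"
    by (simp only: restrict_rep_apply a cfunctions_cnj coord_embed_hom(5)
        representation_cnj[OF \<rho> coord_embed_cfunctions])
  fix b assume b: "b \<in> cfunctions X"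
  show "restrict_rep X D1 \<alpha> \<rho> (\<lambda>x. a x + b x) =
      (\<lambda>h. restrict_rep X D1 \<alpha> \<rho> a h + restrict_rep X D1 \<alpha> \<rho> b h)"
    by (simp only: restrict_rep_apply a b cfunctions_add coord_embed_hom(1)
        representation_add[OF \<rho> coord_embed_cfunctions coord_embed_cfunctions])
  show "restrict_rep X D1 \<alpha> \<rho> (\<lambda>x. a x * b x) = restrict_rep X D1 \<alpha> \<rho> a \<circ> restrict_rep X D1 \<alpha> \<rho> b"
    by (simp only: restrict_rep_apply a b cfunctions_mult coord_embed_hom(3)
        representation_mult[OF \<rho> coord_embed_cfunctions coord_embed_cfunctions])
qed

text \<open>All four spaces are ranges of images of indicators, and the embedding of C(X) takes the
  indicators of \<open>topspace X\<close> and \<open>D1\<close> to those of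
  \<open>topspace Xt\<close> and \<open>D1t\<close>. The conditions on the initial and final spaces
  thus agree for \<open>\<rho>\<close> and its restriction.\<close>

lemma range_restrict_rep:
  assumes \<rho>: "representation Xt \<rho>"
  shows "{restrict_rep X D1 \<alpha> \<rho> a h | a h. a \<in> cfunctions_on (topspace X) X} =
      {\<rho> b h | b h. b \<in> cfunctions_on (topspace Xt) Xt}"
    and "{restrict_rep X D1 \<alpha> \<rho> a h | a h. a \<in> cfunctions_on D1 X} =
      {\<rho> b h | b h. b \<in> cfunctions_on D1t Xt}"
  unfolding representation_range_indicator[OF \<rho> openin_topspace closedin_topspace]
    representation_range_indicator[OF \<rho> D1t_open D1t_closed]
    representation_range_indicator[OF restrict_representation[OF \<rho>] openin_topspace closedin_topspace]
    representation_range_indicator[OF restrict_representation[OF \<rho>] D1_open D1_closed]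
    restrict_rep_apply[OF cfunctions_one] coord_embed_one coord_embed_D1
    restrict_rep_apply[OF cfunctions_indicator[OF D1_open D1_closed]]
  by (rule refl)+

lemma restrict_CovRep:
  assumes "(\<rho>, U) \<in> CovRep Xt D1t (topspace Xt) \<delta>t"
  shows "(restrict_rep X D1 \<alpha> \<rho>, U) \<in> CovRep X D1 (topspace X) (endo D1 \<alpha>)"
proof -
  note \<rho> = CovRep_representation[OF assms]
  have "U \<circ> restrict_rep X D1 \<alpha> \<rho> a \<circ> cadjoint U = restrict_rep X D1 \<alpha> \<rho> (endo D1 \<alpha> a)"
    if a: "a \<in> cfunctions X" for a
    by (simp only: restrict_rep_apply a endo_cfunctions
        CovRep_covariant[OF assms coord_embed_cfunctions[OF a]] endo_coord_embed_0)
  then show ?thesis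
    unfolding CovRep_def mem_Collect_eq prod.case range_restrict_rep[OF \<rho>]
    using restrict_representation[OF \<rho>] CovRep_partial_isometry[OF assms] CovRep_initial[OF assms]
      CovRep_final[OF assms]
    by (intro conjI ballI)
qed

text \<open>Sandwiching the covariance relation gives \<open>\<rho> b = U\<^sup>* \<rho> (\<delta>t b) U\<close>, which reduces the
  coordinate \<open>n + 1\<close> to the coordinate \<open>n\<close>.\<close>

lemma restrict_CovRep_inj:
  assumes 1: "(\<rho>1, U) \<in> CovRep Xt D1t (topspace Xt) \<delta>t"
    and 2: "(\<rho>2, U) \<in> CovRep Xt D1t (topspace Xt) \<delta>t"
    and eq: "restrict_rep X D1 \<alpha> \<rho>1 = restrict_rep X D1 \<alpha> \<rho>2"
  shows "\<rho>1 = \<rho>2"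
proof -
  have step: "\<rho> b = cadjoint U \<circ> \<rho> (\<delta>t b) \<circ> U"
    if \<rho>: "(\<rho>, U) \<in> CovRep Xt D1t (topspace Xt) \<delta>t" and b: "b \<in> cfunctions Xt" for \<rho> b
  proof -
    note rep = CovRep_representation[OF \<rho>]
    have "cadjoint U \<circ> \<rho> (\<delta>t b) \<circ> U = (cadjoint U \<circ> U) \<circ> \<rho> b \<circ> (cadjoint U \<circ> U)"
      by (simp only: CovRep_covariant[OF \<rho> b, symmetric] comp_assoc)
    also have "\<dots> = \<rho> b"
      by (simp only: CovRep_adjoint_comp(1)[OF \<rho>] representation_one[OF rep b])
    finally show ?thesis by simp
  qed
  have coord: "\<rho>1 (coord_embed n a) = \<rho>2 (coord_embed n a)" if "a \<in> cfunctions X" for n a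
    using that
  proof (induction n arbitrary: a)
    case 0
    then show ?case using fun_cong[OF eq, of a] by (simp add: restrict_rep_apply)
  next
    case (Suc n)
    have "indicator D1 \<in> cfunctions X" by (rule cfunctions_indicator[OF D1_open D1_closed])
    \<comment> \<open>Lowering the index leaves the factor \<open>indicator D1t\<close>; for the
      induction hypothesis it has to be a function of coordinate n as well.\<close>
    then obtain d where d: "d \<in> cfunctions X" "coord_embed n d = indicator D1t"
      using coord_embed_lift[of "indicator D1" 0 n] coord_embed_D1 by auto
    have \<delta>: "\<delta>t (coord_embed (Suc n) a) = coord_embed n (\<lambda>x. a x * d x)"
      by (simp only: endo_coord_embed coord_embed_hom(3) d(2))
    have "\<rho>1 (coord_embed (Suc n) a) = cadjoint U \<circ> \<rho>1 (coord_embed n (\<lambda>x. a x * d x)) \<circ> U"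
      using step[OF 1 coord_embed_cfunctions[OF Suc.prems]] \<delta> by simp
    also have "\<dots> = cadjoint U \<circ> \<rho>2 (coord_embed n (\<lambda>x. a x * d x)) \<circ> U"
      by (simp only: Suc.IH[OF cfunctions_mult[OF Suc.prems d(1)]])
    also have "\<dots> = \<rho>2 (coord_embed (Suc n) a)"
      using step[OF 2 coord_embed_cfunctions[OF Suc.prems]] \<delta> by simp
    finally show ?case .
  qed
  show ?thesis
  proof (rule representation_eqI[OF CovRep_representation[OF 1] CovRep_representation[OF 2]
        coord_algebra_subset _ coord_algebra_dense])
    show "\<rho>1 f = \<rho>2 f" if "f \<in> coord_algebra" for f
      using that coord unfolding coord_algebra_def by auto
  qed
qed

text \<open>Level 0 of the extension is \<open>\<pi>\<close> itself, so restriction gives it back;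
  the conditions on the spaces of \<open>U\<close> come from \<open>range_restrict_rep\<close> and
  covariance from \<open>extension_covariant\<close>.\<close>

lemma restrict_CovRep_surj:
  assumes CovRep: "(\<pi>, U) \<in> CovRep X D1 (topspace X) (endo D1 \<alpha>)"
  obtains \<rho> where "(\<rho>, U) \<in> CovRep Xt D1t (topspace Xt) \<delta>t" "restrict_rep X D1 \<alpha> \<rho> = \<pi>"
proof -
  interpret covariant_pair X D1 \<alpha> \<pi> U by unfold_locales (rule CovRep)
  obtain \<rho> where \<rho>: "representation Xt \<rho>"
    and eq: "\<And>n a. a \<in> cfunctions X \<Longrightarrow> \<rho> (coord_embed n a) = iter_rep n a"
    by (rule extension_representation) blast
  have restr: "restrict_rep X D1 \<alpha> \<rho> = \<pi>"
  proof (rule PiE_ext)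
    show "restrict_rep X D1 \<alpha> \<rho> \<in> cfunctions X \<rightarrow>\<^sub>E bounded_operators"
      using restrict_representation[OF \<rho>] unfolding representation_def by blast
    show "\<pi> \<in> cfunctions X \<rightarrow>\<^sub>E bounded_operators"
      using rep unfolding representation_def by blast
    show "restrict_rep X D1 \<alpha> \<rho> a = \<pi> a" if "a \<in> cfunctions X" for a
      using that by (simp add: restrict_rep_apply eq)
  qed
  have "(\<rho>, U) \<in> CovRep Xt D1t (topspace Xt) \<delta>t"
    unfolding CovRep_def mem_Collect_eq prod.case range_restrict_rep[OF \<rho>, symmetric] restr
    using \<rho> CovRep_partial_isometry[OF CovRep] CovRep_initial[OF CovRep] CovRep_final[OF CovRep]
      extension_covariant[OF \<rho> eq]
    by (intro conjI ballI)
  then show thesis using restr by (rule that)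
qed

lemma bij_betw_restrict_CovRep:
  "bij_betw (\<lambda>(\<rho>, U). (restrict_rep X D1 \<alpha> \<rho>, U))
    (CovRep Xt D1t (topspace Xt) \<delta>t) (CovRep X D1 (topspace X) (endo D1 \<alpha>))"
  unfolding bij_betw_def
proof
  show "inj_on (\<lambda>(\<rho>, U). (restrict_rep X D1 \<alpha> \<rho>, U)) (CovRep Xt D1t (topspace Xt) \<delta>t)"
    using restrict_CovRep_inj by (auto simp: inj_on_def)
  show "(\<lambda>(\<rho>, U). (restrict_rep X D1 \<alpha> \<rho>, U)) ` CovRep Xt D1t (topspace Xt) \<delta>t =
      CovRep X D1 (topspace X) (endo D1 \<alpha>)"
  proof
    show "(\<lambda>(\<rho>, U). (restrict_rep X D1 \<alpha> \<rho>, U)) ` CovRep Xt D1t (topspace Xt) \<delta>t \<subseteq>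
        CovRep X D1 (topspace X) (endo D1 \<alpha>)"
      using restrict_CovRep by auto
    show "CovRep X D1 (topspace X) (endo D1 \<alpha>) \<subseteq>
        (\<lambda>(\<rho>, U). (restrict_rep X D1 \<alpha> \<rho>, U)) ` CovRep Xt D1t (topspace Xt) \<delta>t"
    proof
      fix p assume p: "p \<in> CovRep X D1 (topspace X) (endo D1 \<alpha>)"
      obtain \<pi> U where [simp]: "p = (\<pi>, U)" by fastforce
      obtain \<rho> where "(\<rho>, U) \<in> CovRep Xt D1t (topspace Xt) \<delta>t" "restrict_rep X D1 \<alpha> \<rho> = \<pi>"
        using restrict_CovRep_surj p by auto
      then show "p \<in> (\<lambda>(\<rho>, U). (restrict_rep X D1 \<alpha> \<rho>, U)) ` CovRep Xt D1t (topspace Xt) \<delta>t"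
        by (intro image_eqI[of _ _ "(\<rho>, U)"]) simp_all
    qed
  qed
qed

end

theorem corollary3p15:
  fixes X :: "'a topology" and D1 Dm1 :: "'a set" and \<alpha> :: "'a \<Rightarrow> 'a"
  assumes "compact_space X" and "Hausdorff_space X"
    and "openin X D1" and "closedin X D1"
    and "continuous_map (subtopology X D1) X \<alpha>"
    and "Dm1 = \<alpha> ` D1" and "openin X Dm1"
    and "inj_on (endo D1 \<alpha>) (cfunctions X)"
  shows "bij_betw (\<lambda>(\<rho>, U). (restrict_rep X D1 \<alpha> \<rho>, U))
    (CovRep (ext_space X D1 \<alpha>) (ext_preimage X D1 \<alpha> D1) (ext_preimage X D1 \<alpha> Dm1)
      (endo (ext_preimage X D1 \<alpha> D1) (ext_map \<alpha>)) ::
        ((((nat \<Rightarrow> 'a option) \<Rightarrow> complex) \<Rightarrow> 'h \<Rightarrow> 'h) \<times> ('h::complex_hilbert_space \<Rightarrow> 'h)) set)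
    (CovRep X D1 Dm1 (endo D1 \<alpha>))"
proof -
  have onto: "\<alpha> ` D1 = topspace X"
    using assms(7,8) unfolding assms(6) by (rule inj_endo_imp_surj[OF assms(1,2,4,5)])
  interpret onto_partial_map X D1 \<alpha>
    by unfold_locales (fact assms onto)+
  show ?thesis
    unfolding assms(6) onto ext_preimage_topspace by (rule bij_betw_restrict_CovRep)
qed

end
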